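(* Let $\mathcal{R}$ be a rule set (a finite set of existential rules), $\mathcal{D}$ a database, and $\exists\vec x\,q(\vec x)$ a Boolean conjunctive query. Then: 1. $\mathtt{Prove}(\mathcal{D}\vdash\exists\vec x\,q(\vec x))=\mathtt{True}$ if and only if there is an $n\in\mathbb{N}$ such that $\mathbf{Ch}_n(\mathcal{D},\mathcal{R})\models\exists\vec x\,q(\vec x)$, if and only if $\mathbf{Ch}_\infty(\mathcal{D},\mathcal{R})\models\exists\vec x\,q(\vec x)$. 2. If $\mathtt{Prove}(\mathcal{D}\vdash\exists\vec x\,q(\vec x))\neq\mathtt{True}$ (i.e. the algorithm returns $\mathtt{False}$ or does not terminate), then $\mathcal{I}\equiv\mathbf{Ch}_\infty(\mathcal{D},\mathcal{R})$ (homomorphic equivalence), where $\mathcal{I}$ is the witnessing counter-model extracted from the failed proof-search.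
   Context: **Syntax.** $\mathbf{C}$ and $\mathbf{V}$ are disjoint denumerable sets of constants and variables; $\mathbf{T}=\mathbf{C}\cup\mathbf{V}$ is the set of terms. $\mathbf{P}$ is a denumerable set of predicates with denumerably many of each arity; $\top$ is a special unary predicate, not in $\mathbf{P}$, that does not occur in databases, rules or queries. An atom is $p(t_1,\dots,t_n)$ with $p$ an $n$-ary predicate and $t_i\in\mathbf{T}$; it is ground if all $t_i\in\mathbf{C}$. $\phi(t/x)$ is (capture-avoiding) substitution of $t$ for the free occurrences of $x$ in $\phi$. An instance is a (possibly infinite) set of atoms; a database is a finite set of ground atoms. $\mathbf{T}(\Gamma)$ is the set of constants and free variables occurring in $\Gamma$. For an instance $\mathcal{I}$, $\mathcal{I}^\top=\mathcal{I}\cup\{\top(c)\mid c\in\mathbf{C}\}$; $\mathcal{I}$ is an interpretation iff $\mathcal{I}^\top=\mathcal{I}$. **Homomorphisms.** A homomorphism from instance $\mathcal{I}$ to instance $\mathcal{J}$ is a map $\pi$ from terms of $\mathcal{I}$ to terms of $\mathcal{J}$ fixing all constants and such that $p(t_1,\dots,t_n)\in\mathcal{I}$ implies $p(\pi(t_1),\dots,\pi(t_n))\in\mathcal{J}$. $\mathcal{I}\equiv\mathcal{J}$ iff there are homomorphisms in both directions. **Existential rules and queries.** An existential rule is a sentence $\rho=\forall\vec x\vec y\,\beta(\vec x,\vec y)\to\exists\vec z\,\alpha(\vec y,\vec z)$, where the body $\beta=\mathrm{body}(\rho)$ and head $\alpha=\mathrm{head}(\rho)$ are (nonempty, finite) conjunctions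 of atoms over constants and the variables $\vec x,\vec y$, respectively $\vec y,\vec z$; all of $\vec x,\vec y$ occur in $\beta$. Conjunctions of atoms are identified with sets of atoms when convenient. A Boolean conjunctive query (BCQ) is $\exists\vec x\,q(\vec x)$ with $q$ a (nonempty, finite) conjunction of atoms over constants and the variables $\vec x$, all of which occur in $q$. For an instance $\mathcal{I}$, an $\mathcal{I}$-assignment maps variables to elements of $\mathbf{T}(\mathcal{I})$ and constants to themselves (only its values on the variables of the formula it is applied to matter); $\mathcal{I}\models\exists\vec x\,q(\vec x)$ iff there is an $\mathcal{I}$-assignment $\mu$ with $\mu(q(\vec x))\subseteq\mathcal{I}$. $\mu[\vec t/\vec z]$ is $\mu$ modified to send $\vec z$ to $\vec t$. **Chase.** A trigger in $\mathcal{I}$ is a pair $\tau=(\rho,\mu)$ with $\rho\in\mathcal{R}$ and $\mu$ an $\mathcal{I}$-assignment such that $\mu(\beta(\vec x,\vec y))\subseteq\mathcal{I}$; its application is $\tau(\mathcal{I})=\mathcal{I}\cup\alpha(\mu(\vec y),\vec z)$ with $\vec z$ taken to be a tuple of pairwise distinct fresh variables (different triggers using different fresh variables). $\mathbf{Ch}_0(\mathcal{I},\mathcal{R})=\mathcal{I}$; $\mathbf{Ch}_1(\mathcal{I},\mathcal{R})=\mathcal{I}\cup\bigcup\{\tau(\mathcal{I})\mid\tau\text{ a trigger in }\mathcal{I}\}$; $\mathbf{Ch}_{n+1}(\mathcal{I},\mathcal{R})=\mathbf{Ch}_1(\mathbf{Ch}_n(\mathcal{I},\mathcal{R}),\mathcal{R})$;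 $\mathbf{Ch}_\infty(\mathcal{I},\mathcal{R})=\big(\bigcup_{i\in\mathbb{N}}\mathbf{Ch}_i(\mathcal{I},\mathcal{R})\big)^\top$. **Proof-search.** A sequent $\Gamma\vdash\Delta$ is a pair of finite sets of formulae. On inputs $\mathcal{D}\vdash\exists\vec x\,q(\vec x)$, $\Gamma$ is always a finite set of atoms and $\Delta$ a finite set of formulae built from atoms with $\wedge,\exists$. A sequent is saturated iff: (id) no atom is in $\Gamma\cap\Delta$; ($\wedge_R$) if $\phi\wedge\psi\in\Delta$ then $\phi\in\Delta$ or $\psi\in\Delta$; ($\exists_R$) if $\exists x\phi\in\Delta$ then $\phi(t/x)\in\Delta$ for every $t\in\mathbf{T}(\Gamma)$; (er) for each $\rho\in\mathcal{R}$ and $\Gamma$-assignment $\mu$ with $\mu(\mathrm{body}(\rho))\subseteq\Gamma$ there are $\vec t\in\mathbf{T}(\Gamma)$ with $\mu[\vec t/\vec z](\mathrm{head}(\rho))\subseteq\Gamma$. Fix a cyclic order on $\mathcal{R}$. $\mathtt{Prove}(\Gamma\vdash\Delta)$ does the first applicable of the following: 1. if $\Gamma\vdash\Delta$ is saturated, return $\mathtt{False}$; 2. if some atom is in $\Gamma\cap\Delta$, return $\mathtt{True}$; 3. if $\phi\wedge\psi\in\Delta$ with $\phi,\psi\notin\Delta$, recursively call $\mathtt{Prove}(\Gamma\vdash\phi,\Delta)$ and $\mathtt{Prove}(\Gamma\vdash\psi,\Delta)$; return $\mathtt{False}$ if one of them is $\mathtt{False}$, and $\mathtt{True}$ otherwise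 (i.e. when both return $\mathtt{True}$); 4. if $\exists x\phi\in\Delta$, $t\in\mathbf{T}(\Gamma)$ and $\phi(t/x)\notin\Delta$, return $\mathtt{Prove}(\Gamma\vdash\phi(t/x),\Delta)$; 5. otherwise take the next rule $\rho\in\mathcal{R}$ in the cyclic order (skipping rules that do not qualify) for which there is a $\Gamma$-assignment $\mu$ with $\mu(\beta(\vec x,\vec y))\subseteq\Gamma$ but no $\vec t\in\mathbf{T}(\Gamma)$ with $\mu[\vec t/\vec z](\alpha(\vec y,\vec z))\subseteq\Gamma$, and return $\mathtt{Prove}(\alpha(\mu(\vec y),\vec z),\Gamma\vdash\Delta)$ with $\vec z$ fresh. The choices are fair: no applicable rule instance $(\rho,\mu)$ is delayed indefinitely along a branch of the search. **Witnessing counter-model.** Consider the tree of all recursive calls, rooted at $\mathcal{D}\vdash\exists\vec x\,q(\vec x)$. An open branch is a path from the root $(\Gamma_0\vdash\Delta_0),(\Gamma_1\vdash\Delta_1),\dots$ that is either infinite or ends in a saturated sequent. The interpretation extracted from it is $\mathcal{I}=\big(\bigcup_i\Gamma_i\big)^\top$. When $\mathtt{Prove}$ does not return $\mathtt{True}$, the witnessing counter-model is the interpretation extracted from an open branch. *)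

theory Defs
  imports Main "HOL-Library.FuncSet" "HOL-Library.Extended_Nat"
begin

section \<open>Terms, atoms, instances\<close>

datatype trm = Const nat | Var nat

text \<open>A predicate of \<open>\<^bold>P\<close> is a name together with an arity, and the arity is the length of the
  argument list: \<open>Atom p [t\<^sub>1, \<dots>, t\<^sub>n]\<close> stands for the \<open>p\<close>-th predicate of arity \<open>n\<close> applied to
  \<open>t\<^sub>1, \<dots>, t\<^sub>n\<close>.  So there are denumerably many predicates of each arity, and no atom is
  ill-formed.  The additional unary predicate \<open>\<top>\<close> has its own constructor.\<close>

datatype 't atom = Atom nat "'t list" | is_Top: Top 't

type_synonym inst = "trm atom set"

definition terms :: "inst \<Rightarrow> trm set" where
  "terms I = (\<Union>a\<in>I. set_atom a)"

definition vars :: "inst \<Rightarrow> nat set" where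
  "vars I = {x. Var x \<in> terms I}"

definition top_free :: "inst \<Rightarrow> bool" where
  "top_free I \<longleftrightarrow> (\<forall>a\<in>I. \<not> is_Top a)"

definition database :: "inst \<Rightarrow> bool" where
  "database D \<longleftrightarrow> finite D \<and> terms D \<subseteq> range Const \<and> top_free D"

definition top_closure :: "inst \<Rightarrow> inst" where
  "top_closure I = I \<union> (\<lambda>c. Top (Const c)) ` UNIV"

definition homomorphism :: "(trm \<Rightarrow> trm) \<Rightarrow> inst \<Rightarrow> inst \<Rightarrow> bool" where
  "homomorphism h I J \<longleftrightarrow>
     h ` terms I \<subseteq> terms J \<and>
     (\<forall>c. Const c \<in> terms I \<longrightarrow> h (Const c) = Const c) \<and>
     (\<forall>a\<in>I. map_atom h a \<in> J)"

definition hom_equiv :: "inst \<Rightarrow> inst \<Rightarrow> bool" where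
  "hom_equiv I J \<longleftrightarrow> (\<exists>h. homomorphism h I J) \<and> (\<exists>h. homomorphism h J I)"


section \<open>Assignments\<close>

primrec subst_trm :: "(nat \<Rightarrow> trm) \<Rightarrow> trm \<Rightarrow> trm" where
  "subst_trm \<mu> (Const c) = Const c"
| "subst_trm \<mu> (Var x) = \<mu> x"

definition subst_atoms :: "(nat \<Rightarrow> trm) \<Rightarrow> inst \<Rightarrow> inst" where
  "subst_atoms \<mu> A = map_atom (subst_trm \<mu>) ` A"

text \<open>Only the values on the variables \<open>X\<close> of the formula at hand matter, so assignments that
  agree on \<open>X\<close> are identified.  Without this, one and the same trigger of the chase would be
  counted infinitely often.\<close>

definition assignments :: "nat set \<Rightarrow> inst \<Rightarrow> (nat \<Rightarrow> trm) set" where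
  "assignments X I = X \<rightarrow>\<^sub>E terms I"


section \<open>Existential rules\<close>

text \<open>The quantifier prefix of a rule is determined by its body and head: \<open>z\<close> consists of the
  variables of the head that are not in the body, all others are universally quantified.\<close>

datatype rule = Rule (body: inst) (head: inst)

definition exvars :: "rule \<Rightarrow> nat set" where
  "exvars \<rho> = vars (head \<rho>) - vars (body \<rho>)"

definition existential_rule :: "rule \<Rightarrow> bool" where
  "existential_rule \<rho> \<longleftrightarrow>
     finite (body \<rho>) \<and> body \<rho> \<noteq> {} \<and> top_free (body \<rho>) \<and>
     finite (head \<rho>) \<and> head \<rho> \<noteq> {} \<and> top_free (head \<rho>)"

definition rule_set :: "rule set \<Rightarrow> bool" where
  "rule_set R \<longleftrightarrow> finite R \<and> (\<forall>\<rho>\<in>R. existential_rule \<rho>)"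


section \<open>Formulae and Boolean conjunctive queries\<close>

datatype fm = FAtom "trm atom" | FAnd fm fm | FEx nat fm

primrec fv :: "fm \<Rightarrow> nat set" where
  "fv (FAtom a) = vars {a}"
| "fv (FAnd \<phi> \<psi>) = fv \<phi> \<union> fv \<psi>"
| "fv (FEx x \<phi>) = fv \<phi> - {x}"

text \<open>Capture-avoiding simultaneous substitution: a bound variable is renamed exactly if it
  would capture a variable introduced by \<open>\<sigma>\<close>.\<close>

primrec subst_fm :: "(nat \<Rightarrow> trm) \<Rightarrow> fm \<Rightarrow> fm" where
  "subst_fm \<sigma> (FAtom a) = FAtom (map_atom (subst_trm \<sigma>) a)"
| "subst_fm \<sigma> (FAnd \<phi> \<psi>) = FAnd (subst_fm \<sigma> \<phi>) (subst_fm \<sigma> \<psi>)"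
| "subst_fm \<sigma> (FEx x \<phi>) =
     (let V = {v. Var v \<in> \<sigma> ` (fv \<phi> - {x})};
          x' = (if x \<in> V then LEAST v. v \<notin> V else x)
      in FEx x' (subst_fm (\<sigma>(x := Var x')) \<phi>))"

definition subst1 :: "fm \<Rightarrow> trm \<Rightarrow> nat \<Rightarrow> fm" where
  "subst1 \<phi> t x = subst_fm (Var(x := t)) \<phi>"

primrec conjunction :: "fm \<Rightarrow> bool" where
  "conjunction (FAtom a) = True"
| "conjunction (FAnd \<phi> \<psi>) = (conjunction \<phi> \<and> conjunction \<psi>)"
| "conjunction (FEx x \<phi>) = False"

primrec conjuncts :: "fm \<Rightarrow> inst" where
  "conjuncts (FAtom a) = {a}"
| "conjuncts (FAnd \<phi> \<psi>) = conjuncts \<phi> \<union> conjuncts \<psi>"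
| "conjuncts (FEx x \<phi>) = {}"

definition bcq :: "nat list \<Rightarrow> fm \<Rightarrow> bool" where
  "bcq xs q \<longleftrightarrow> conjunction q \<and> top_free (conjuncts q) \<and> distinct xs \<and> set xs = fv q"

definition exists_fm :: "nat list \<Rightarrow> fm \<Rightarrow> fm" where
  "exists_fm xs q = foldr FEx xs q"

text \<open>Satisfaction of the query \<open>exists_fm xs q\<close>.\<close>

definition satisfies :: "inst \<Rightarrow> nat list \<Rightarrow> fm \<Rightarrow> bool" where
  "satisfies I xs q \<longleftrightarrow> (\<exists>\<mu>\<in>assignments (set xs) I. subst_atoms \<mu> (conjuncts q) \<subseteq> I)"


section \<open>The chase\<close>

definition triggers :: "rule set \<Rightarrow> inst \<Rightarrow> (rule \<times> (nat \<Rightarrow> trm)) set" where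
  "triggers R I =
     {(\<rho>, \<mu>). \<rho> \<in> R \<and> \<mu> \<in> assignments (vars (body \<rho>)) I \<and> subst_atoms \<mu> (body \<rho>) \<subseteq> I}"

definition new_atoms :: "(nat \<Rightarrow> nat) \<Rightarrow> rule \<times> (nat \<Rightarrow> trm) \<Rightarrow> inst" where
  "new_atoms \<nu> = (\<lambda>(\<rho>, \<mu>). subst_atoms (override_on \<mu> (Var \<circ> \<nu>) (exvars \<rho>)) (head \<rho>))"

text \<open>\<open>chase_step R I J\<close> says that \<open>J\<close> is \<open>\<^bold>C\<^bold>h\<^sub>1(I, R)\<close> for some choice \<open>\<nu>\<close> of the fresh variables
  of each trigger, and \<open>chase R D Ch\<close> that \<open>Ch n\<close> is \<open>\<^bold>C\<^bold>h\<^sub>n(D, R)\<close>.\<close>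

definition chase_step :: "rule set \<Rightarrow> inst \<Rightarrow> inst \<Rightarrow> bool" where
  "chase_step R I J \<longleftrightarrow> (\<exists>\<nu>.
     (\<forall>\<tau>\<in>triggers R I. inj_on (\<nu> \<tau>) (exvars (fst \<tau>)) \<and> \<nu> \<tau> ` exvars (fst \<tau>) \<inter> vars I = {}) \<and>
     (\<forall>\<tau>\<in>triggers R I. \<forall>\<tau>'\<in>triggers R I. \<tau> \<noteq> \<tau>' \<longrightarrow>
        \<nu> \<tau> ` exvars (fst \<tau>) \<inter> \<nu> \<tau>' ` exvars (fst \<tau>') = {}) \<and>
     J = I \<union> (\<Union>\<tau>\<in>triggers R I. new_atoms (\<nu> \<tau>) \<tau>))"

definition chase :: "rule set \<Rightarrow> inst \<Rightarrow> (nat \<Rightarrow> inst) \<Rightarrow> bool" where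
  "chase R D Ch \<longleftrightarrow> Ch 0 = D \<and> (\<forall>n. chase_step R (Ch n) (Ch (Suc n)))"

definition chase_limit :: "(nat \<Rightarrow> inst) \<Rightarrow> inst" where
  "chase_limit Ch = top_closure (\<Union>n. Ch n)"


section \<open>Proof search\<close>

definition axiomatic :: "inst \<Rightarrow> fm set \<Rightarrow> bool" where
  "axiomatic \<Gamma> \<Delta> \<longleftrightarrow> (\<exists>a\<in>\<Gamma>. FAtom a \<in> \<Delta>)"

definition applicable :: "inst \<Rightarrow> rule \<Rightarrow> (nat \<Rightarrow> trm) \<Rightarrow> bool" where
  "applicable \<Gamma> \<rho> \<mu> \<longleftrightarrow>
     \<mu> \<in> assignments (vars (body \<rho>)) \<Gamma> \<and> subst_atoms \<mu> (body \<rho>) \<subseteq> \<Gamma> \<and>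
     \<not> (\<exists>\<theta>. \<theta> ` exvars \<rho> \<subseteq> terms \<Gamma> \<and> subst_atoms (override_on \<mu> \<theta> (exvars \<rho>)) (head \<rho>) \<subseteq> \<Gamma>)"

definition saturated :: "rule set \<Rightarrow> inst \<Rightarrow> fm set \<Rightarrow> bool" where
  "saturated R \<Gamma> \<Delta> \<longleftrightarrow>
     \<not> axiomatic \<Gamma> \<Delta> \<and>
     (\<forall>\<phi> \<psi>. FAnd \<phi> \<psi> \<in> \<Delta> \<longrightarrow> \<phi> \<in> \<Delta> \<or> \<psi> \<in> \<Delta>) \<and>
     (\<forall>x \<phi>. FEx x \<phi> \<in> \<Delta> \<longrightarrow> (\<forall>t\<in>terms \<Gamma>. subst1 \<phi> t x \<in> \<Delta>)) \<and>
     (\<forall>\<rho>\<in>R. \<forall>\<mu>\<in>assignments (vars (body \<rho>)) \<Gamma>. subst_atoms \<mu> (body \<rho>) \<subseteq> \<Gamma> \<longrightarrow>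
        (\<exists>\<theta>. \<theta> ` exvars \<rho> \<subseteq> terms \<Gamma> \<and> subst_atoms (override_on \<mu> \<theta> (exvars \<rho>)) (head \<rho>) \<subseteq> \<Gamma>))"

text \<open>The third component of a call lists the rule set in its cyclic order, beginning with the
  rule that is next in turn.\<close>

datatype call = Call (lhs: inst) (rhs: "fm set") (rules: "rule list")

definition call_saturated :: "call \<Rightarrow> bool" where
  "call_saturated c \<longleftrightarrow> saturated (set (rules c)) (lhs c) (rhs c)"

definition and_reducible :: "fm set \<Rightarrow> fm \<Rightarrow> fm \<Rightarrow> bool" where
  "and_reducible \<Delta> \<phi> \<psi> \<longleftrightarrow> FAnd \<phi> \<psi> \<in> \<Delta> \<and> \<phi> \<notin> \<Delta> \<and> \<psi> \<notin> \<Delta>"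

definition ex_reducible :: "inst \<Rightarrow> fm set \<Rightarrow> nat \<Rightarrow> fm \<Rightarrow> trm \<Rightarrow> bool" where
  "ex_reducible \<Gamma> \<Delta> x \<phi> t \<longleftrightarrow> FEx x \<phi> \<in> \<Delta> \<and> t \<in> terms \<Gamma> \<and> subst1 \<phi> t x \<notin> \<Delta>"

text \<open>\<open>calls c cs\<close>: the call \<open>c\<close> of \<open>Prove\<close> may make exactly the immediate recursive calls \<open>cs\<close>.
  The negated premises express that the first applicable case is taken.  In the last case the
  cyclic order is rotated such that the search for the next rule resumes after \<open>\<rho>\<close>.\<close>

inductive calls :: "call \<Rightarrow> call list \<Rightarrow> bool" where
  saturated: "calls (Call \<Gamma> \<Delta> rs) []"
    if "saturated (set rs) \<Gamma> \<Delta>"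
| axiomatic: "calls (Call \<Gamma> \<Delta> rs) []"
    if "\<not> saturated (set rs) \<Gamma> \<Delta>" "axiomatic \<Gamma> \<Delta>"
| conj: "calls (Call \<Gamma> \<Delta> rs) [Call \<Gamma> (insert \<phi> \<Delta>) rs, Call \<Gamma> (insert \<psi> \<Delta>) rs]"
    if "\<not> saturated (set rs) \<Gamma> \<Delta>" "\<not> axiomatic \<Gamma> \<Delta>"
      "and_reducible \<Delta> \<phi> \<psi>"
| ex: "calls (Call \<Gamma> \<Delta> rs) [Call \<Gamma> (insert (subst1 \<phi> t x) \<Delta>) rs]"
    if "\<not> saturated (set rs) \<Gamma> \<Delta>" "\<not> axiomatic \<Gamma> \<Delta>"
      "\<nexists>\<phi> \<psi>. and_reducible \<Delta> \<phi> \<psi>"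
      "ex_reducible \<Gamma> \<Delta> x \<phi> t"
| er: "calls (Call \<Gamma> \<Delta> (ps @ \<rho> # qs)) [Call (new_atoms \<nu> (\<rho>, \<mu>) \<union> \<Gamma>) \<Delta> (qs @ ps @ [\<rho>])]"
    if "\<not> saturated (set (ps @ \<rho> # qs)) \<Gamma> \<Delta>" "\<not> axiomatic \<Gamma> \<Delta>"
      "\<nexists>\<phi> \<psi>. and_reducible \<Delta> \<phi> \<psi>"
      "\<nexists>x \<phi> t. ex_reducible \<Gamma> \<Delta> x \<phi> t"
      "\<forall>\<rho>'\<in>set ps. \<nexists>\<mu>'. applicable \<Gamma> \<rho>' \<mu>'"
      "applicable \<Gamma> \<rho> \<mu>"
      "inj_on \<nu> (exvars \<rho>)"
      "\<nu> ` exvars \<rho> \<inter> (vars \<Gamma> \<union> (\<Union>\<phi>\<in>\<Delta>. fv \<phi>)) = {}"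

text \<open>The possibly infinite tree of all recursive calls.\<close>

codatatype tree = Node (call: call) (children: "tree list")

coinductive search_tree :: "tree \<Rightarrow> bool" where
  "calls (call T) (map call (children T)) \<Longrightarrow> (\<forall>U\<in>set (children T). search_tree U) \<Longrightarrow> search_tree T"

text \<open>The nodes of the path \<open>b\<close> are \<open>b i\<close> for \<open>i \<le> n\<close>; the path is infinite if \<open>n = \<infinity>\<close>.\<close>

definition path :: "tree \<Rightarrow> (nat \<Rightarrow> tree) \<Rightarrow> enat \<Rightarrow> bool" where
  "path T b n \<longleftrightarrow> b 0 = T \<and> (\<forall>i. enat i < n \<longrightarrow> b (Suc i) \<in> set (children (b i)))"

text \<open>Bodies stay matched and satisfied heads stay satisfied along a path, and applying a rule
  instance satisfies its head.  So an instance is delayed indefinitely exactly if from some point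
  on it is applicable at every node of an infinite path.\<close>

definition fair :: "rule set \<Rightarrow> tree \<Rightarrow> bool" where
  "fair R T \<longleftrightarrow> (\<forall>b. path T b \<infinity> \<longrightarrow>
     (\<forall>i. \<forall>\<rho>\<in>R. \<forall>\<mu>. applicable (lhs (call (b i))) \<rho> \<mu> \<longrightarrow>
        (\<exists>j\<ge>i. \<not> applicable (lhs (call (b j))) \<rho> \<mu>)))"

text \<open>\<open>T\<close> is the tree of recursive calls of a run of \<open>Prove\<close> on \<open>D \<turnstile> \<phi>\<close> with rule set \<open>R\<close>, for
  some cyclic order on \<open>R\<close> and some admissible resolution of the choices.\<close>

definition proof_search :: "rule set \<Rightarrow> inst \<Rightarrow> fm \<Rightarrow> tree \<Rightarrow> bool" where
  "proof_search R D \<phi> T \<longleftrightarrow>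
     (\<exists>rs. distinct rs \<and> set rs = R \<and> call T = Call D {\<phi>} rs) \<and> search_tree T \<and> fair R T"

text \<open>\<open>returns T v\<close>: the root call of \<open>T\<close> terminates with value \<open>v\<close>.\<close>

inductive returns :: "tree \<Rightarrow> bool \<Rightarrow> bool" where
  "call_saturated c \<Longrightarrow> returns (Node c []) False"
| "axiomatic (lhs c) (rhs c) \<Longrightarrow> returns (Node c []) True"
| "returns T v \<Longrightarrow> returns (Node c [T]) v"
| "returns T False \<or> returns U False \<Longrightarrow> returns (Node c [T, U]) False"
| "returns T True \<Longrightarrow> returns U True \<Longrightarrow> returns (Node c [T, U]) True"

definition open_branch :: "tree \<Rightarrow> (nat \<Rightarrow> tree) \<Rightarrow> enat \<Rightarrow> bool" where
  "open_branch T b n \<longleftrightarrow>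
     path T b n \<and> (n = \<infinity> \<or> (\<exists>m. n = enat m \<and> call_saturated (call (b m))))"

definition extracted :: "(nat \<Rightarrow> tree) \<Rightarrow> enat \<Rightarrow> inst" where
  "extracted b n = top_closure (\<Union>i\<in>{i. enat i \<le> n}. lhs (call (b i)))"

definition witnessing_counter_model :: "tree \<Rightarrow> inst \<Rightarrow> bool" where
  "witnessing_counter_model T I \<longleftrightarrow> (\<exists>b n. open_branch T b n \<and> I = extracted b n)"

end

theory Submission
  imports Defs
begin

text \<open>The chase and the left-hand sides along an open branch of the search are both limits of a
  sequence that starts with \<open>D\<close> and applies triggers with fresh variables.  Every such limit maps
  into every model of \<open>R\<close> that contains \<open>D\<close>, and both limits are themselves such models (for the
  branch by fairness), so they are homomorphically equivalent.  For soundness, an axiomatic sequent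
  is traced back: any homomorphism from a left-hand side into a model makes some formula on the
  right-hand side true.  For completeness, a Hintikka-style argument shows that no formula on the
  right of an open branch is true in the extracted model.  The point there is that between two rule
  applications only finitely many formulae can be added on the right, so an infinite branch applies
  rules infinitely often, and each time all other reductions have been exhausted.\<close>

section \<open>Substitution and evaluation of formulae\<close>

lemma mem_vars_iff: "x \<in> vars A \<longleftrightarrow> Var x \<in> terms A"
  by (simp add: vars_def)

lemma terms_mono: "A \<subseteq> B \<Longrightarrow> terms A \<subseteq> terms B"
  by (auto simp: terms_def)

lemma finite_terms: "finite A \<Longrightarrow> finite (terms A)"
proof -
  have "finite (set_atom a)" for a :: "trm atom"
    by (cases a) auto
  then show "finite A \<Longrightarrow> finite (terms A)"
    by (simp add: terms_def)
qed

lemma finite_vars: "finite A \<Longrightarrow> finite (vars A)"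
  unfolding vars_def by (rule finite_imageD[of Var])
    (auto intro: finite_subset[OF _ finite_terms] inj_onI)

lemma finite_fv: "finite (fv \<phi>)"
  by (induction \<phi>) (auto simp: finite_vars)

lemma subst_trm_comp: "subst_trm e (subst_trm \<mu> t) = subst_trm (\<lambda>x. subst_trm e (\<mu> x)) t"
  by (cases t) auto

lemma subst_trm_Var: "subst_trm Var = id"
proof
  show "subst_trm Var t = id t" for t by (cases t) auto
qed

lemma subst_trm_cong: "(\<And>x. t = Var x \<Longrightarrow> e x = e' x) \<Longrightarrow> subst_trm e t = subst_trm e' t"
  by (cases t) auto

lemma map_atom_subst_cong:
  "(\<And>x. x \<in> vars {a} \<Longrightarrow> e x = e' x) \<Longrightarrow> map_atom (subst_trm e) a = map_atom (subst_trm e') a"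
  by (intro atom.map_cong refl subst_trm_cong) (auto simp: vars_def terms_def)

lemma subst_atoms_mono: "A \<subseteq> B \<Longrightarrow> subst_atoms \<mu> A \<subseteq> subst_atoms \<mu> B"
  by (auto simp: subst_atoms_def)

lemma subst_atoms_Var: "subst_atoms Var A = A"
  by (simp add: subst_atoms_def subst_trm_Var atom.map_id)

lemma subst_atoms_comp:
  "subst_atoms e (subst_atoms \<mu> A) = subst_atoms (\<lambda>x. subst_trm e (\<mu> x)) A"
  by (simp add: subst_atoms_def image_image atom.map_comp comp_def subst_trm_comp)

lemma subst_atoms_cong:
  "(\<And>x. x \<in> vars A \<Longrightarrow> e x = e' x) \<Longrightarrow> subst_atoms e A = subst_atoms e' A"
  unfolding subst_atoms_def
  by (intro image_cong refl map_atom_subst_cong) (auto simp: vars_def terms_def)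

lemma terms_subst_atoms: "terms (subst_atoms \<mu> A) = subst_trm \<mu> ` terms A"
  by (auto simp: terms_def subst_atoms_def atom.set_map)

lemma subst_var_in_terms:
  assumes "x \<in> vars A" "subst_atoms \<mu> A \<subseteq> I" shows "\<mu> x \<in> terms I"
proof -
  have "subst_trm \<mu> (Var x) \<in> terms (subst_atoms \<mu> A)"
    using assms(1) unfolding terms_subst_atoms mem_vars_iff by (rule imageI)
  then show ?thesis using terms_mono[OF assms(2)] by auto
qed

lemma subst_trm_in_terms:
  assumes "t \<in> terms A" "subst_atoms \<mu> A \<subseteq> I" shows "subst_trm \<mu> t \<in> terms I"
  using assms terms_mono[OF assms(2)] by (auto simp: terms_subst_atoms)

text \<open>Truth with the terms of the instance as domain. The quantifier ranges over
  \<open>terms I\<close> because the search instantiates quantifiers with exactly the terms on the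
  left. Under the valuation \<open>Var\<close> each variable denotes itself.\<close>

primrec holds :: "inst \<Rightarrow> (nat \<Rightarrow> trm) \<Rightarrow> fm \<Rightarrow> bool" where
  "holds I e (FAtom a) = (map_atom (subst_trm e) a \<in> I)"
| "holds I e (FAnd \<phi> \<psi>) = (holds I e \<phi> \<and> holds I e \<psi>)"
| "holds I e (FEx x \<phi>) = (\<exists>t\<in>terms I. holds I (e(x := t)) \<phi>)"

lemma holds_cong: "(\<And>x. x \<in> fv \<phi> \<Longrightarrow> e x = e' x) \<Longrightarrow> holds I e \<phi> = holds I e' \<phi>"
proof (induction \<phi> arbitrary: e e')
  case (FAtom a)
  then have "map_atom (subst_trm e) a = map_atom (subst_trm e') a"
    by (intro map_atom_subst_cong) auto
  then show ?case by simp
next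
  case (FAnd \<phi> \<psi>)
  show ?case using FAnd.IH[of e e'] FAnd.prems by auto
next
  case (FEx x \<phi>)
  have "holds I (e(x := t)) \<phi> = holds I (e'(x := t)) \<phi>" for t
    by (rule FEx.IH) (use FEx.prems in auto)
  then show ?case by simp
qed

text \<open>Substitution lemma. In the quantifier case both the valuation and the substitution
  change, so the induction leaves both arbitrary. The bound variable \<open>x'\<close> lies outside
  \<open>V\<close>, so updating the valuation at \<open>x'\<close> cannot affect the images of the
  other free variables.\<close>

lemma holds_subst_fm: "holds I e (subst_fm \<sigma> \<phi>) = holds I (\<lambda>x. subst_trm e (\<sigma> x)) \<phi>"
proof (induction \<phi> arbitrary: e \<sigma>)
  case (FAtom a)
  then show ?case by (simp add: atom.map_comp comp_def subst_trm_comp)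
next
  case (FAnd \<phi> \<psi>)
  then show ?case by simp
next
  case (FEx x \<phi>)
  define V where "V = {v. Var v \<in> \<sigma> ` (fv \<phi> - {x})}"
  define x' where "x' = (if x \<in> V then LEAST v. v \<notin> V else x)"
  \<comment> \<open>Finiteness leaves some variable outside \<open>V\<close>, so the
    \<open>LEAST\<close> used for renaming is well-defined.\<close>
  have "finite V" unfolding V_def
    by (rule finite_imageD[of Var])
      (auto intro: finite_subset[of _ "\<sigma> ` (fv \<phi> - {x})"] finite_fv inj_onI)
  then have "\<exists>v. v \<notin> V" by (rule ex_new_if_finite[OF infinite_UNIV_nat])
  then have "(LEAST v. v \<notin> V) \<notin> V" by (rule LeastI_ex)
  then have x': "x' \<notin> V" by (simp add: x'_def)
  have "holds I (e(x' := t)) (subst_fm (\<sigma>(x := Var x')) \<phi>) =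
      holds I ((\<lambda>y. subst_trm e (\<sigma> y))(x := t)) \<phi>" for t
    unfolding FEx.IH
  proof (rule holds_cong)
    fix y assume "y \<in> fv \<phi>"
    then have "\<sigma> y \<noteq> Var x'" if "y \<noteq> x" using that x' unfolding V_def by force
    then show "subst_trm (e(x' := t)) ((\<sigma>(x := Var x')) y) =
        ((\<lambda>y. subst_trm e (\<sigma> y))(x := t)) y"
      by (auto intro: subst_trm_cong)
  qed
  moreover have "subst_fm \<sigma> (FEx x \<phi>) = FEx x' (subst_fm (\<sigma>(x := Var x')) \<phi>)"
    by (simp add: V_def x'_def Let_def)
  ultimately show ?case by simp
qed

lemma holds_subst1: "holds I e (subst1 \<phi> t x) = holds I (e(x := subst_trm e t)) \<phi>"
proof -
  have "(\<lambda>y. subst_trm e ((Var(x := t)) y)) = e(x := subst_trm e t)" by auto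
  then show ?thesis by (simp add: subst1_def holds_subst_fm)
qed

text \<open>Instances of a quantified formula are not subformulae of it but are smaller; this
  justifies the later inductions on \<open>size\<close>.\<close>

lemma size_subst_fm: "size (subst_fm \<sigma> \<phi>) = size \<phi>"
  by (induction \<phi> arbitrary: \<sigma>) (simp_all add: Let_def)

section \<open>Queries as formulae and as sets of atoms\<close>

lemma holds_conjunction: "conjunction q \<Longrightarrow> holds I e q \<longleftrightarrow> subst_atoms e (conjuncts q) \<subseteq> I"
  by (induction q) (auto simp: subst_atoms_def)

lemma finite_conjuncts: "finite (conjuncts q)"
  by (induction q) auto

lemma fv_conjunction: "conjunction q \<Longrightarrow> fv q = vars (conjuncts q)"
  by (induction q) (auto simp: vars_def terms_def)

lemma holds_exists_fm:
  "holds I e (exists_fm xs q) \<longleftrightarrow>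
    (\<exists>\<mu>. \<mu> ` set xs \<subseteq> terms I \<and> holds I (override_on e \<mu> (set xs)) q)"
proof (induction xs arbitrary: e)
  case Nil
  then show ?case by (simp add: exists_fm_def)
next
  case (Cons x xs)
  have *: "holds I e (exists_fm (x # xs) q) \<longleftrightarrow> (\<exists>t\<in>terms I. \<exists>\<mu>. \<mu> ` set xs \<subseteq> terms I \<and>
      holds I (override_on (e(x := t)) \<mu> (set xs)) q)"
    using Cons.IH by (simp only: exists_fm_def foldr.simps comp_apply holds.simps)
  show ?case unfolding *
  proof safe
    fix t \<mu> assume t: "t \<in> terms I" and \<mu>: "\<mu> ` set xs \<subseteq> terms I"
      and h: "holds I (override_on (e(x := t)) \<mu> (set xs)) q"
    \<comment> \<open>If \<open>x\<close> is quantified again in \<open>xs\<close>, the inner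
      binding wins, so \<open>t\<close> is used at \<open>x\<close> only when \<open>x\<close> is
      not in \<open>xs\<close>.\<close>
    define \<mu>' where "\<mu>' = override_on (\<mu>(x := t)) \<mu> (set xs)"
    have "override_on (e(x := t)) \<mu> (set xs) = override_on e \<mu>' (set (x # xs))"
      by (auto simp: \<mu>'_def override_on_def)
    moreover have "\<mu>' ` set (x # xs) \<subseteq> terms I"
      using t \<mu> by (auto simp: \<mu>'_def override_on_def)
    ultimately show "\<exists>\<mu>. \<mu> ` set (x # xs) \<subseteq> terms I \<and>
        holds I (override_on e \<mu> (set (x # xs))) q"
      using h by metis
  next
    fix \<mu> assume \<mu>: "\<mu> ` set (x # xs) \<subseteq> terms I"
      and h: "holds I (override_on e \<mu> (set (x # xs))) q"
    have "override_on (e(x := \<mu> x)) \<mu> (set xs) = override_on e \<mu> (set (x # xs))"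
      by (auto simp: override_on_def)
    then show "\<exists>t\<in>terms I. \<exists>\<mu>. \<mu> ` set xs \<subseteq> terms I \<and>
        holds I (override_on (e(x := t)) \<mu> (set xs)) q"
      using \<mu> h by (intro bexI[of _ "\<mu> x"] exI[of _ \<mu>]) auto
  qed
qed

text \<open>Every query variable occurs in some atom, so its value is automatically a term of
  \<open>I\<close>; restricting the valuation to the query variables then gives an
  assignment.\<close>

lemma satisfies_iff:
  assumes "bcq xs q"
  shows "satisfies I xs q \<longleftrightarrow> (\<exists>\<mu>. subst_atoms \<mu> (conjuncts q) \<subseteq> I)"
proof
  assume "satisfies I xs q"
  then show "\<exists>\<mu>. subst_atoms \<mu> (conjuncts q) \<subseteq> I" by (auto simp: satisfies_def)
next
  assume "\<exists>\<mu>. subst_atoms \<mu> (conjuncts q) \<subseteq> I"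
  then obtain \<mu> where \<mu>: "subst_atoms \<mu> (conjuncts q) \<subseteq> I" by blast
  have xs: "set xs = vars (conjuncts q)" using assms fv_conjunction by (auto simp: bcq_def)
  have "subst_atoms (restrict \<mu> (set xs)) (conjuncts q) = subst_atoms \<mu> (conjuncts q)"
    by (rule subst_atoms_cong) (simp add: xs)
  moreover have "restrict \<mu> (set xs) \<in> assignments (set xs) I"
    using subst_var_in_terms[OF _ \<mu>] by (auto simp: assignments_def xs)
  ultimately show "satisfies I xs q" using \<mu> by (auto simp: satisfies_def)
qed

lemma holds_exists_fm_iff_satisfies:
  assumes "bcq xs q" shows "holds I e (exists_fm xs q) \<longleftrightarrow> satisfies I xs q"
proof -
  have q: "conjunction q" "vars (conjuncts q) = set xs"
    using assms fv_conjunction by (auto simp: bcq_def)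
  have *: "subst_atoms (override_on e \<mu> (set xs)) (conjuncts q) = subst_atoms \<mu> (conjuncts q)" for \<mu>
    by (rule subst_atoms_cong) (simp add: q override_on_def)
  show ?thesis
    unfolding holds_exists_fm holds_conjunction[OF q(1)] * satisfies_iff[OF assms]
    using subst_var_in_terms q(2) by blast
qed

section \<open>Models of a rule set and applications of triggers\<close>

text \<open>Neither \<mu> nor \<theta> is confined to the terms of \<open>M\<close>: each variable
  that matters occurs in a body or head atom whose image lies in \<open>M\<close>.\<close>

definition rule_model :: "rule set \<Rightarrow> inst \<Rightarrow> bool" where
  "rule_model R M \<longleftrightarrow> (\<forall>\<rho>\<in>R. \<forall>\<mu>. subst_atoms \<mu> (body \<rho>) \<subseteq> M \<longrightarrow>
     (\<exists>\<theta>. subst_atoms (override_on \<mu> \<theta> (exvars \<rho>)) (head \<rho>) \<subseteq> M))"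

definition fresh_choice :: "inst \<Rightarrow> (rule \<times> (nat \<Rightarrow> trm)) set \<Rightarrow>
    (rule \<times> (nat \<Rightarrow> trm) \<Rightarrow> nat \<Rightarrow> nat) \<Rightarrow> bool" where
  "fresh_choice I X \<nu> \<longleftrightarrow>
     (\<forall>\<tau>\<in>X. inj_on (\<nu> \<tau>) (exvars (fst \<tau>)) \<and> \<nu> \<tau> ` exvars (fst \<tau>) \<inter> vars I = {}) \<and>
     (\<forall>\<tau>\<in>X. \<forall>\<tau>'\<in>X. \<tau> \<noteq> \<tau>' \<longrightarrow> \<nu> \<tau> ` exvars (fst \<tau>) \<inter> \<nu> \<tau>' ` exvars (fst \<tau>') = {})"

text \<open>Common generalisation of the two processes: \<open>X\<close> consists of all triggers in
  a chase step, of one trigger when the search applies a rule, and is empty in every other step of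
  the search.\<close>

definition rule_step :: "rule set \<Rightarrow> inst \<Rightarrow> inst \<Rightarrow> bool" where
  "rule_step R I J \<longleftrightarrow> (\<exists>X \<nu>. X \<subseteq> triggers R I \<and> fresh_choice I X \<nu> \<and>
     J = I \<union> (\<Union>\<tau>\<in>X. new_atoms (\<nu> \<tau>) \<tau>))"

lemma chase_step_iff: "chase_step R I J \<longleftrightarrow>
    (\<exists>\<nu>. fresh_choice I (triggers R I) \<nu> \<and> J = I \<union> (\<Union>\<tau>\<in>triggers R I. new_atoms (\<nu> \<tau>) \<tau>))"
  by (simp only: chase_step_def fresh_choice_def conj_assoc)

lemma chase_step_rule_step: "chase_step R I J \<Longrightarrow> rule_step R I J"
  unfolding chase_step_iff rule_step_def by blast

lemma rule_step_refl: "rule_step R I I"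
  unfolding rule_step_def fresh_choice_def by (rule exI[of _ "{}"]) simp

lemma rule_step_subset: "rule_step R I J \<Longrightarrow> I \<subseteq> J"
  by (auto simp: rule_step_def)

text \<open>Head variables are existential or occur in the body. The lemma allows passing between a
  valuation and its restriction to the body variables.\<close>

lemma subst_override_on_cong:
  assumes "\<And>x. x \<in> vars (body \<rho>) \<Longrightarrow> \<mu> x = \<mu>' x"
  shows "subst_atoms (override_on \<mu> \<theta> (exvars \<rho>)) (head \<rho>) =
    subst_atoms (override_on \<mu>' \<theta> (exvars \<rho>)) (head \<rho>)"
  by (rule subst_atoms_cong) (use assms in \<open>auto simp: override_on_def exvars_def\<close>)

text \<open>The valuation sends each triggered body into \<open>M\<close>, the model supplies
  witnesses for the head, and the fresh variables are sent to these witnesses. Agreement is asserted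
  at all variables that are not fresh, beyond those of \<open>I\<close>, because soundness also
  needs it at the free variables of the right-hand side.\<close>

lemma extend_valuation:
  assumes M: "rule_model R M" and X: "X \<subseteq> triggers R I" and fresh: "fresh_choice I X \<nu>"
    and e: "subst_atoms e I \<subseteq> M"
  obtains e' where "\<And>x. x \<notin> (\<Union>\<tau>\<in>X. \<nu> \<tau> ` exvars (fst \<tau>)) \<Longrightarrow> e' x = e x"
    and "subst_atoms e' (I \<union> (\<Union>\<tau>\<in>X. new_atoms (\<nu> \<tau>) \<tau>)) \<subseteq> M"
proof -
  have "\<exists>\<theta>. subst_atoms (override_on (\<lambda>x. subst_trm e (snd \<tau> x)) \<theta> (exvars (fst \<tau>)))
      (head (fst \<tau>)) \<subseteq> M" if "\<tau> \<in> X" for \<tau>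
  proof -
    have \<tau>: "fst \<tau> \<in> R" "subst_atoms (snd \<tau>) (body (fst \<tau>)) \<subseteq> I"
      using X that by (force simp: triggers_def)+
    then have "subst_atoms e (subst_atoms (snd \<tau>) (body (fst \<tau>))) \<subseteq> M"
      using subst_atoms_mono e by blast
    then show ?thesis using M \<tau>(1) by (simp add: rule_model_def subst_atoms_comp)
  qed
  then obtain \<theta> where \<theta>: "\<And>\<tau>. \<tau> \<in> X \<Longrightarrow>
      subst_atoms (override_on (\<lambda>x. subst_trm e (snd \<tau> x)) (\<theta> \<tau>) (exvars (fst \<tau>)))
      (head (fst \<tau>)) \<subseteq> M"
    by metis
  \<comment> \<open>A fresh variable determines its trigger by disjointness and its existential
    variable by injectivity, so \<open>THE\<close> and \<open>inv_into\<close> recover both.\<close>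
  define e' where "e' x = (if \<exists>\<tau>\<in>X. x \<in> \<nu> \<tau> ` exvars (fst \<tau>)
    then let \<tau> = (THE \<tau>. \<tau> \<in> X \<and> x \<in> \<nu> \<tau> ` exvars (fst \<tau>))
      in \<theta> \<tau> (inv_into (exvars (fst \<tau>)) (\<nu> \<tau>) x)
    else e x)" for x
  have old: "e' x = e x" if "x \<notin> (\<Union>\<tau>\<in>X. \<nu> \<tau> ` exvars (fst \<tau>))" for x
    using that by (auto simp: e'_def)
  have new: "e' (\<nu> \<tau> z) = \<theta> \<tau> z" if "\<tau> \<in> X" "z \<in> exvars (fst \<tau>)" for \<tau> z
  proof -
    have "(THE \<tau>'. \<tau>' \<in> X \<and> \<nu> \<tau> z \<in> \<nu> \<tau>' ` exvars (fst \<tau>')) = \<tau>"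
    proof (rule the_equality)
      show "\<tau>' = \<tau>" if "\<tau>' \<in> X \<and> \<nu> \<tau> z \<in> \<nu> \<tau>' ` exvars (fst \<tau>')" for \<tau>'
        using that \<open>\<tau> \<in> X\<close> \<open>z \<in> exvars (fst \<tau>)\<close> fresh unfolding fresh_choice_def by blast
    qed (use that in auto)
    moreover have "inj_on (\<nu> \<tau>) (exvars (fst \<tau>))"
      using that fresh by (auto simp: fresh_choice_def)
    ultimately show ?thesis using that by (auto simp: e'_def Let_def)
  qed
  have on_I: "e' x = e x" if "x \<in> vars I" for x
    by (rule old) (use that fresh in \<open>auto simp: fresh_choice_def\<close>)
  have "subst_atoms e' (new_atoms (\<nu> \<tau>) \<tau>) \<subseteq> M" if "\<tau> \<in> X" for \<tau>
  proof -
    have \<mu>: "snd \<tau> \<in> assignments (vars (body (fst \<tau>))) I"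
      using X that by (auto simp: triggers_def)
    have "subst_atoms e' (new_atoms (\<nu> \<tau>) \<tau>) = subst_atoms
        (\<lambda>x. subst_trm e' (override_on (snd \<tau>) (Var \<circ> \<nu> \<tau>) (exvars (fst \<tau>)) x)) (head (fst \<tau>))"
      by (simp add: new_atoms_def case_prod_beta subst_atoms_comp)
    also have "\<dots> = subst_atoms
        (override_on (\<lambda>x. subst_trm e (snd \<tau> x)) (\<theta> \<tau>) (exvars (fst \<tau>))) (head (fst \<tau>))"
    proof (rule subst_atoms_cong)
      fix x assume x: "x \<in> vars (head (fst \<tau>))"
      show "subst_trm e' (override_on (snd \<tau>) (Var \<circ> \<nu> \<tau>) (exvars (fst \<tau>)) x) =
          override_on (\<lambda>x. subst_trm e (snd \<tau> x)) (\<theta> \<tau>) (exvars (fst \<tau>)) x"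
      proof (cases "x \<in> exvars (fst \<tau>)")
        case True
        then show ?thesis using new that by (simp add: override_on_def)
      next
        case False
        then have "x \<in> vars (body (fst \<tau>))" using x by (auto simp: exvars_def)
        then have "snd \<tau> x \<in> terms I" using \<mu> by (auto simp: assignments_def)
        then have "subst_trm e' (snd \<tau> x) = subst_trm e (snd \<tau> x)"
          by (intro subst_trm_cong on_I) (simp add: mem_vars_iff)
        then show ?thesis using False by (simp add: override_on_def)
      qed
    qed
    finally show ?thesis using \<theta>[OF that] by simp
  qed
  moreover have "subst_atoms e' I \<subseteq> M"
    using e subst_atoms_cong[of I e' e] on_I by auto
  ultimately have "subst_atoms e' (I \<union> (\<Union>\<tau>\<in>X. new_atoms (\<nu> \<tau>) \<tau>)) \<subseteq> M"
    by (auto simp: subst_atoms_def)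
  with old show ?thesis by (rule that)
qed

lemma rule_step_extend:
  assumes "rule_model R M" "rule_step R I J" "subst_atoms e I \<subseteq> M"
  shows "\<exists>e'. (\<forall>x\<in>vars I. e' x = e x) \<and> subst_atoms e' J \<subseteq> M"
proof -
  obtain X \<nu> where X: "X \<subseteq> triggers R I" "fresh_choice I X \<nu>"
    and J: "J = I \<union> (\<Union>\<tau>\<in>X. new_atoms (\<nu> \<tau>) \<tau>)"
    using assms(2) unfolding rule_step_def by blast
  obtain e' where e': "\<And>x. x \<notin> (\<Union>\<tau>\<in>X. \<nu> \<tau> ` exvars (fst \<tau>)) \<Longrightarrow> e' x = e x"
    "subst_atoms e' J \<subseteq> M"
    using extend_valuation[OF assms(1) X assms(3)] unfolding J by blast
  have "\<forall>x\<in>vars I. e' x = e x"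
    using X(2) by (intro ballI e'(1)) (auto simp: fresh_choice_def)
  with e'(2) show ?thesis by blast
qed

text \<open>Valuations are extended step by step by dependent choice. A value once given to a
  variable of a stage never changes, so the valuations glue to one on the union.\<close>

lemma rule_steps_limit_universal:
  assumes M: "rule_model R M" and steps: "\<And>n. rule_step R (S n) (S (Suc n))" and "S 0 \<subseteq> M"
  shows "\<exists>e. subst_atoms e (\<Union>n. S n) \<subseteq> M"
proof -
  have "\<exists>f. \<forall>n. subst_atoms (f n) (S n) \<subseteq> M \<and> (\<forall>x\<in>vars (S n). f (Suc n) x = f n x)"
  proof (rule dependent_nat_choice)
    show "\<exists>e. subst_atoms e (S 0) \<subseteq> M"
      using assms(3) by (intro exI[of _ Var]) (simp add: subst_atoms_Var)
    show "\<exists>e'. subst_atoms e' (S (Suc n)) \<subseteq> M \<and> (\<forall>x\<in>vars (S n). e' x = e x)"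
      if "subst_atoms e (S n) \<subseteq> M" for e n
      using rule_step_extend[OF M steps that] by blast
  qed
  then obtain f where f: "\<And>n. subst_atoms (f n) (S n) \<subseteq> M"
    "\<And>n x. x \<in> vars (S n) \<Longrightarrow> f (Suc n) x = f n x"
    by blast
  have mono: "S m \<subseteq> S n" if "m \<le> n" for m n
    by (rule lift_Suc_mono_le[of S]) (use that rule_step_subset[OF steps] in auto)
  have stable: "f n x = f m x" if "m \<le> n" "x \<in> vars (S m)" for m n x
    using that(1)
  proof (induction n rule: dec_induct)
    case (step n)
    have "x \<in> vars (S n)"
      using that(2) terms_mono[OF mono[OF step(1)]] by (auto simp: mem_vars_iff)
    then show ?case using f(2) step.IH by simp
  qed simp
  \<comment> \<open>Each variable is evaluated at the first stage in which it occurs.\<close>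
  define e where "e x = f (LEAST n. x \<in> vars (S n)) x" for x
  have "subst_atoms e (S n) = subst_atoms (f n) (S n)" for n
  proof (rule subst_atoms_cong)
    fix x assume x: "x \<in> vars (S n)"
    then have "(LEAST n. x \<in> vars (S n)) \<le> n" "x \<in> vars (S (LEAST n. x \<in> vars (S n)))"
      by (rule Least_le, rule LeastI)
    then show "e x = f n x" unfolding e_def by (rule stable[symmetric])
  qed
  then have "subst_atoms e (S n) \<subseteq> M" for n using f(1) by simp
  then show ?thesis by (auto simp: subst_atoms_def)
qed

text \<open>Compactness: a match of a finite body or query in a limit is already present at a finite
  stage.\<close>

lemma finite_subset_UN_incseq:
  fixes S :: "nat \<Rightarrow> 'a set"
  assumes "\<And>n. S n \<subseteq> S (Suc n)" "finite A" "A \<subseteq> (\<Union>n. S n)"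
  obtains n where "A \<subseteq> S n"
proof -
  have mono: "m \<le> n \<Longrightarrow> S m \<subseteq> S n" for m n by (rule lift_Suc_mono_le[of S, OF assms(1)])
  have "\<exists>n. A \<subseteq> S n" using assms(2,3)
  proof (induction A)
    case (insert a A)
    then obtain m n where "A \<subseteq> S m" "a \<in> S n" by auto
    then have "insert a A \<subseteq> S (max m n)"
      using mono[of m "max m n"] mono[of n "max m n"] by auto
    then show ?case by blast
  qed simp
  then show ?thesis using that by blast
qed

text \<open>A valuation of variables induces a map that fixes all constants, hence preserves the
  added atoms \<open>Top (Const c)\<close> and is a homomorphism.\<close>

lemma hom_equiv_top_closure:
  assumes "subst_atoms e I \<subseteq> J" "subst_atoms e' J \<subseteq> I"
  shows "hom_equiv (top_closure I) (top_closure J)"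
proof -
  have "homomorphism (subst_trm e) (top_closure A) (top_closure B)"
    if "subst_atoms e A \<subseteq> B" for e A B
  proof -
    have *: "subst_atoms e (top_closure A) \<subseteq> top_closure B"
      using that by (auto simp: top_closure_def subst_atoms_def)
    then show ?thesis
      using subst_trm_in_terms[OF _ *] by (auto simp: homomorphism_def subst_atoms_def)
  qed
  with assms show ?thesis unfolding hom_equiv_def by blast
qed

section \<open>The chase\<close>

lemma chase_rule_step: "chase R D Ch \<Longrightarrow> rule_step R (Ch n) (Ch (Suc n))"
  by (simp add: chase_def chase_step_rule_step)

lemma chase_incseq: "chase R D Ch \<Longrightarrow> Ch n \<subseteq> Ch (Suc n)"
  by (intro rule_step_subset chase_rule_step)

text \<open>The finite body is matched at some stage \<open>n\<close>, and the chase applies all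
  triggers of that stage at once, so the head is present at stage \<open>Suc n\<close>.\<close>

lemma chase_rule_model:
  assumes R: "rule_set R" and Ch: "chase R D Ch"
  shows "rule_model R (\<Union>n. Ch n)"
  unfolding rule_model_def
proof (intro ballI allI impI)
  fix \<rho> \<mu> assume \<rho>: "\<rho> \<in> R" and \<mu>: "subst_atoms \<mu> (body \<rho>) \<subseteq> (\<Union>n. Ch n)"
  have "finite (body \<rho>)" using R \<rho> by (auto simp: rule_set_def existential_rule_def)
  then have "finite (subst_atoms \<mu> (body \<rho>))" by (simp add: subst_atoms_def)
  then obtain n where n: "subst_atoms \<mu> (body \<rho>) \<subseteq> Ch n"
    using finite_subset_UN_incseq[OF chase_incseq[OF Ch] _ \<mu>] by blast
  \<comment> \<open>Triggers carry assignments that are undefined off the body variables, so the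
    restriction is the representative to use.\<close>
  let ?\<mu> = "restrict \<mu> (vars (body \<rho>))"
  have "subst_atoms ?\<mu> (body \<rho>) = subst_atoms \<mu> (body \<rho>)" by (rule subst_atoms_cong) simp
  then have "(\<rho>, ?\<mu>) \<in> triggers R (Ch n)"
    using \<rho> n subst_var_in_terms[OF _ n] by (auto simp: triggers_def assignments_def)
  moreover obtain \<nu> where "Ch (Suc n) = Ch n \<union> (\<Union>\<tau>\<in>triggers R (Ch n). new_atoms (\<nu> \<tau>) \<tau>)"
    using Ch unfolding chase_def chase_step_iff by blast
  ultimately have "new_atoms (\<nu> (\<rho>, ?\<mu>)) (\<rho>, ?\<mu>) \<subseteq> Ch (Suc n)" by blast
  moreover have "new_atoms (\<nu> (\<rho>, ?\<mu>)) (\<rho>, ?\<mu>) =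
      subst_atoms (override_on \<mu> (Var \<circ> \<nu> (\<rho>, ?\<mu>)) (exvars \<rho>)) (head \<rho>)"
    unfolding new_atoms_def prod.case by (rule subst_override_on_cong) simp
  ultimately show "\<exists>\<theta>. subst_atoms (override_on \<mu> \<theta> (exvars \<rho>)) (head \<rho>) \<subseteq> (\<Union>n. Ch n)"
    by blast
qed

text \<open>Substitution never turns an ordinary atom into a \<open>Top\<close> atom, so the added
  atoms cannot contribute to a match.\<close>

lemma satisfies_top_closure:
  assumes "bcq xs q" shows "satisfies (top_closure I) xs q \<longleftrightarrow> satisfies I xs q"
proof -
  have *: "map_atom f a \<noteq> Top t" if "a \<in> conjuncts q" for f :: "trm \<Rightarrow> trm" and a t
    using that assms by (cases a) (auto simp: bcq_def top_free_def)
  then have "subst_atoms \<mu> (conjuncts q) \<subseteq> top_closure I \<longleftrightarrow> subst_atoms \<mu> (conjuncts q) \<subseteq> I" for \<mu>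
    using * unfolding subst_atoms_def top_closure_def by blast
  then show ?thesis by (simp add: satisfies_iff[OF assms])
qed

lemma satisfies_UN_incseq:
  assumes "bcq xs q" "\<And>n. S n \<subseteq> S (Suc n)"
  shows "satisfies (\<Union>n. S n) xs q \<longleftrightarrow> (\<exists>n. satisfies (S n) xs q)"
proof -
  have "finite (subst_atoms \<mu> (conjuncts q))" for \<mu>
    by (simp add: subst_atoms_def finite_conjuncts)
  then have "\<exists>n. subst_atoms \<mu> (conjuncts q) \<subseteq> S n"
    if "subst_atoms \<mu> (conjuncts q) \<subseteq> (\<Union>n. S n)" for \<mu>
    using finite_subset_UN_incseq[of S, OF assms(2) _ that] by metis
  then show ?thesis unfolding satisfies_iff[OF assms(1)] by blast
qed

section \<open>Soundness of the search\<close>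

lemma applicable_trigger: "applicable \<Gamma> \<rho> \<mu> \<Longrightarrow> \<rho> \<in> R \<Longrightarrow> (\<rho>, \<mu>) \<in> triggers R \<Gamma>"
  by (auto simp: applicable_def triggers_def)

text \<open>The invariant, that every valuation sending the left into \<open>M\<close> makes
  something on the right true, passes from the recursive calls back to the caller. The case
  \<open>er\<close> uses the premise at a valuation extended to the fresh variables, hence the
  quantification over valuations; freshness for the right-hand side carries the truth of \<phi> back
  from \<open>e'\<close> to \<open>e\<close>.\<close>

lemma calls_sound:
  assumes "calls c cs" "cs \<noteq> []" "rule_model (set (rules c)) M"
    and "\<And>c' e. c' \<in> set cs \<Longrightarrow> subst_atoms e (lhs c') \<subseteq> M \<Longrightarrow> \<exists>\<phi>\<in>rhs c'. holds M e \<phi>"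
    and "subst_atoms e (lhs c) \<subseteq> M"
  shows "\<exists>\<phi>\<in>rhs c. holds M e \<phi>"
  using assms
proof cases
  case (conj rs \<Gamma> \<Delta> \<phi> \<psi>)
  then have "(\<exists>\<chi>\<in>insert \<phi> \<Delta>. holds M e \<chi>) \<and> (\<exists>\<chi>\<in>insert \<psi> \<Delta>. holds M e \<chi>)"
    using assms(4)[of "Call \<Gamma> (insert \<phi> \<Delta>) rs" e] assms(4)[of "Call \<Gamma> (insert \<psi> \<Delta>) rs" e]
      assms(5) by simp
  moreover have "FAnd \<phi> \<psi> \<in> \<Delta>" using conj by (simp add: and_reducible_def)
  ultimately have "\<exists>\<chi>\<in>\<Delta>. holds M e \<chi>" by (metis holds.simps(2) insert_iff)
  then show ?thesis using conj by simp
next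
  case (ex rs \<Gamma> \<Delta> x \<phi> t)
  then have "\<exists>\<chi>\<in>insert (subst1 \<phi> t x) \<Delta>. holds M e \<chi>"
    using assms(4)[of "Call \<Gamma> (insert (subst1 \<phi> t x) \<Delta>) rs" e] assms(5) by simp
  moreover have "subst_trm e t \<in> terms M"
    using ex assms(5) by (auto simp: ex_reducible_def intro: subst_trm_in_terms)
  moreover have "FEx x \<phi> \<in> \<Delta>" using ex by (simp add: ex_reducible_def)
  ultimately have "\<exists>\<chi>\<in>\<Delta>. holds M e \<chi>" by (metis holds.simps(3) holds_subst1 insert_iff)
  then show ?thesis using ex by simp
next
  case (er ps \<rho> qs \<Gamma> \<Delta> \<mu> \<nu>)
  have X: "{(\<rho>, \<mu>)} \<subseteq> triggers (set (rules c)) \<Gamma>"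
    using er applicable_trigger by auto
  have fresh: "fresh_choice \<Gamma> {(\<rho>, \<mu>)} (\<lambda>_. \<nu>)"
    using er by (auto simp: fresh_choice_def)
  have "subst_atoms e \<Gamma> \<subseteq> M" using er assms(5) by simp
  from extend_valuation[OF assms(3) X fresh this] obtain e' where
    e': "\<And>x. x \<notin> \<nu> ` exvars \<rho> \<Longrightarrow> e' x = e x"
    "subst_atoms e' (\<Gamma> \<union> new_atoms \<nu> (\<rho>, \<mu>)) \<subseteq> M"
    by (metis (no_types, lifting) SUP_insert UN_empty fst_conv sup_bot.right_neutral)
  then obtain \<phi> where \<phi>: "\<phi> \<in> \<Delta>" "holds M e' \<phi>"
    using assms(4)[of _ e'] er by (auto simp: Un_commute)
  have "holds M e' \<phi> = holds M e \<phi>"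
    by (rule holds_cong, rule e'(1)) (use er \<phi>(1) in auto)
  then show ?thesis using \<phi> er by auto
qed auto

lemma calls_rules: "calls c cs \<Longrightarrow> c' \<in> set cs \<Longrightarrow> set (rules c') = set (rules c)"
  by (induction rule: calls.induct) auto

lemma search_tree_calls: "search_tree T \<Longrightarrow> calls (call T) (map call (children T))"
  by (auto elim: search_tree.cases)

lemma search_tree_child: "search_tree T \<Longrightarrow> U \<in> set (children T) \<Longrightarrow> search_tree U"
  by (auto elim: search_tree.cases)

text \<open>Induction along the finite computation of the value \<open>True\<close>; at an axiomatic
  leaf the valuation sends the shared atom into \<open>M\<close>.\<close>

lemma returns_True_sound:
  assumes "returns T True" "search_tree T" "rule_model (set (rules (call T))) M"
    "subst_atoms e (lhs (call T)) \<subseteq> M"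
  shows "\<exists>\<phi>\<in>rhs (call T). holds M e \<phi>"
  using assms
proof (induction T "True" arbitrary: e rule: returns.induct)
  case (2 c)
  then obtain a where "a \<in> lhs c" "FAtom a \<in> rhs c" by (auto simp: axiomatic_def)
  then show ?case using 2 by (intro bexI[of _ "FAtom a"]) (auto simp: subst_atoms_def)
next
  case (3 T c)
  have c: "calls c [call T]" using search_tree_calls[OF 3(3)] by simp
  have T: "search_tree T" using search_tree_child[OF 3(3)] by simp
  show ?case unfolding tree.sel
  proof (rule calls_sound[OF c])
    show "\<exists>\<phi>\<in>rhs c'. holds M e \<phi>"
      if "c' \<in> set [call T]" "subst_atoms e (lhs c') \<subseteq> M" for c' e
      using 3(2)[OF T] that 3(4) calls_rules[OF c] by simp
  qed (use 3 in auto)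
next
  case (5 T U c)
  have c: "calls c [call T, call U]" using search_tree_calls[OF 5(5)] by simp
  have T: "search_tree T" "search_tree U" using search_tree_child[OF 5(5)] by simp_all
  show ?case unfolding tree.sel
  proof (rule calls_sound[OF c])
    show "\<exists>\<phi>\<in>rhs c'. holds M e \<phi>"
      if "c' \<in> set [call T, call U]" "subst_atoms e (lhs c') \<subseteq> M" for c' e
      using 5(2)[OF T(1)] 5(4)[OF T(2)] that 5(6) calls_rules[OF c] by auto
  qed (use 5 in auto)
qed simp_all

section \<open>Open branches\<close>

lemma search_tree_children_cases:
  assumes "search_tree T"
  obtains "children T = []" "call_saturated (call T)"
  | "children T = []" "axiomatic (lhs (call T)) (rhs (call T))"
  | U where "children T = [U]"
  | U V where "children T = [U, V]"
  using search_tree_calls[OF assms]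
  by cases (auto simp: call_saturated_def map_eq_Cons_conv intro: that)

text \<open>An unsaturated leaf is axiomatic and returns \<open>True\<close>, and a node whose
  children all return \<open>True\<close> does so too. Failure to return \<open>True\<close>, by
  \<open>False\<close> or by divergence, is thus inherited by some child.\<close>

lemma not_returns_True_child:
  assumes "search_tree T" "\<not> returns T True" "\<not> call_saturated (call T)"
  shows "\<exists>U\<in>set (children T). \<not> returns U True"
  using assms(1)
proof (cases rule: search_tree_children_cases)
  case 2
  then show ?thesis using assms(2) returns.intros(2)[of "call T"] tree.collapse[of T] by metis
next
  case (3 U)
  then show ?thesis using assms(2) returns.intros(3)[of U True "call T"] tree.collapse[of T]
    by (metis list.set_intros(1))
next
  case (4 U V)
  then show ?thesis using assms(2) returns.intros(5)[of U V "call T"] tree.collapse[of T]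
    by (metis list.set_intros(1,2))
qed (use assms in auto)

lemma open_branch_exists:
  assumes "search_tree T" "\<not> returns T True"
  shows "\<exists>b n. open_branch T b n"
proof -
  define P where "P U \<longleftrightarrow> search_tree U \<and> \<not> returns U True" for U
  \<comment> \<open>Dependent choice descends through failing nodes; the clause for
    \<open>i = 0\<close> pins the start, and nothing links a saturated node to its
    successor.\<close>
  have "\<exists>b. \<forall>i. (P (b i) \<and> (i = 0 \<longrightarrow> b i = T)) \<and>
      (\<not> call_saturated (call (b i)) \<longrightarrow> b (Suc i) \<in> set (children (b i)))"
  proof (rule dependent_nat_choice)
    show "\<exists>U. P U \<and> (0 = (0 :: nat) \<longrightarrow> U = T)" using assms by (auto simp: P_def)
  next
    fix U and i :: nat assume "P U \<and> (i = 0 \<longrightarrow> U = T)"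
    then show "\<exists>V. (P V \<and> (Suc i = 0 \<longrightarrow> V = T)) \<and>
        (\<not> call_saturated (call U) \<longrightarrow> V \<in> set (children U))"
      using not_returns_True_child search_tree_child unfolding P_def by blast
  qed
  then obtain b where b0: "b 0 = T"
    and b: "\<And>i. \<not> call_saturated (call (b i)) \<Longrightarrow> b (Suc i) \<in> set (children (b i))"
    by blast
  show ?thesis
  proof (cases "\<exists>m. call_saturated (call (b m))")
    case True
    \<comment> \<open>The path must end at the first saturated node, since the sequence need not
      follow the tree afterwards.\<close>
    define m where "m = (LEAST m. call_saturated (call (b m)))"
    have "call_saturated (call (b m))" unfolding m_def using True by (rule LeastI_ex)
    moreover have "\<not> call_saturated (call (b i))" if "i < m" for i
      using that not_less_Least unfolding m_def by blast
    ultimately have "open_branch T b (enat m)"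
      using b0 b by (auto simp: open_branch_def path_def)
    then show ?thesis by blast
  next
    case False
    then have "open_branch T b \<infinity>" using b0 b by (auto simp: open_branch_def path_def)
    then show ?thesis by blast
  qed
qed

text \<open>A finite open branch is continued by repeating its saturated end, so that finite and infinite
  branches are treated alike.\<close>

locale branch =
  fixes R :: "rule set" and c :: "nat \<Rightarrow> call"
  assumes R: "rule_set R"
    and rules_R: "set (rules (c i)) = R"
    and step: "(\<exists>cs. calls (c i) cs \<and> c (Suc i) \<in> set cs) \<or> call_saturated (c i) \<and> c (Suc i) = c i"
    and fairness: "\<rho> \<in> R \<Longrightarrow> applicable (lhs (c i)) \<rho> \<mu> \<Longrightarrow> \<exists>j\<ge>i. \<not> applicable (lhs (c j)) \<rho> \<mu>"
    and finite_start: "finite (lhs (c 0))" "finite (rhs (c 0))"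
begin

section \<open>Exhausting the reductions on the right\<close>

definition settled :: "call \<Rightarrow> bool" where
  "settled d \<longleftrightarrow> (\<nexists>\<phi> \<psi>. and_reducible (rhs d) \<phi> \<psi>) \<and>
     (\<nexists>x \<phi> t. ex_reducible (lhs d) (rhs d) x \<phi> t)"

lemma not_axiomatic: "\<not> axiomatic (lhs (c i)) (rhs (c i))"
proof -
  have "\<not> axiomatic (lhs d) (rhs d)" if "calls d ds" "d' \<in> set ds" for d d' ds
    using that by (induction rule: calls.induct) auto
  then show ?thesis using step[of i] by (auto simp: call_saturated_def saturated_def)
qed

lemma saturated_settled: "call_saturated d \<Longrightarrow> settled d"
  by (auto simp: call_saturated_def saturated_def settled_def and_reducible_def ex_reducible_def)

text \<open>A closed set containing the right-hand side bounds everything the search can add there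
  while the left-hand side stays fixed.\<close>

definition reduction_closed :: "inst \<Rightarrow> fm set \<Rightarrow> bool" where
  "reduction_closed \<Gamma> C \<longleftrightarrow> (\<forall>\<chi>\<in>C. case \<chi> of FAtom a \<Rightarrow> True | FAnd \<phi> \<psi> \<Rightarrow> \<phi> \<in> C \<and> \<psi> \<in> C
     | FEx x \<phi> \<Rightarrow> \<forall>t\<in>terms \<Gamma>. subst1 \<phi> t x \<in> C)"

lemma reduction_closedD:
  assumes "reduction_closed \<Gamma> C"
  shows "FAnd \<phi> \<psi> \<in> C \<Longrightarrow> \<phi> \<in> C \<and> \<psi> \<in> C"
    and "FEx x \<phi> \<in> C \<Longrightarrow> t \<in> terms \<Gamma> \<Longrightarrow> subst1 \<phi> t x \<in> C"
  using assms[unfolded reduction_closed_def, THEN bspec, of "FAnd \<phi> \<psi>"]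
    assms[unfolded reduction_closed_def, THEN bspec, of "FEx x \<phi>"] by simp_all

text \<open>Rules are applied only once no reduction is left, so an unsettled call must take the
  case \<open>conj\<close> or \<open>ex\<close>, each of which adds a new formula on the right
  only.\<close>

lemma unsettled_step:
  assumes "\<not> settled (c i)"
  shows "lhs (c (Suc i)) = lhs (c i)" and "rhs (c i) \<subset> rhs (c (Suc i))"
    and "reduction_closed (lhs (c i)) C \<Longrightarrow> rhs (c i) \<subseteq> C \<Longrightarrow> rhs (c (Suc i)) \<subseteq> C"
proof -
  obtain cs where cs: "calls (c i) cs" "c (Suc i) \<in> set cs"
    using step[of i] assms saturated_settled by blast
  from cs assms show "lhs (c (Suc i)) = lhs (c i)"
    by cases (auto simp: settled_def)
  show "rhs (c i) \<subset> rhs (c (Suc i))"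
    using cs(1)
  proof cases
    case (conj rs \<Gamma> \<Delta> \<phi> \<psi>)
    then have "rhs (c (Suc i)) = insert \<phi> \<Delta> \<or> rhs (c (Suc i)) = insert \<psi> \<Delta>"
      using cs(2) by auto
    then show ?thesis using conj unfolding and_reducible_def by auto
  next
    case (ex rs \<Gamma> \<Delta> x \<phi> t)
    then have "rhs (c (Suc i)) = insert (subst1 \<phi> t x) \<Delta>"
      using cs(2) by auto
    then show ?thesis using ex unfolding ex_reducible_def by auto
  qed (use cs assms in \<open>auto simp: settled_def\<close>)
  show "rhs (c (Suc i)) \<subseteq> C" if "reduction_closed (lhs (c i)) C" "rhs (c i) \<subseteq> C"
    using cs(1)
  proof cases
    case (conj rs \<Gamma> \<Delta> \<phi> \<psi>)
    then have "FAnd \<phi> \<psi> \<in> C" using that(2) by (auto simp: and_reducible_def)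
    then have "\<phi> \<in> C" "\<psi> \<in> C" using reduction_closedD(1)[OF that(1)] by blast+
    then show ?thesis using conj cs(2) that(2) by auto
  next
    case (ex rs \<Gamma> \<Delta> x \<phi> t)
    then have "FEx x \<phi> \<in> C" "t \<in> terms (lhs (c i))"
      using that(2) by (auto simp: ex_reducible_def)
    then have "subst1 \<phi> t x \<in> C" by (rule reduction_closedD(2)[OF that(1)])
    then show ?thesis using ex cs(2) that(2) by auto
  qed (use cs assms in \<open>auto simp: settled_def\<close>)
qed

text \<open>Reductions and padding leave the left-hand side alone and count as steps with no
  trigger.\<close>

lemma lhs_rule_step: "rule_step R (lhs (c i)) (lhs (c (Suc i)))"
  using step[of i]
proof
  assume "\<exists>cs. calls (c i) cs \<and> c (Suc i) \<in> set cs"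
  then obtain cs where cs: "calls (c i) cs" "c (Suc i) \<in> set cs" by blast
  then show ?thesis
  proof cases
    case (er ps \<rho> qs \<Gamma> \<Delta> \<mu> \<nu>)
    have "\<rho> \<in> R" using er(1) rules_R[of i] by auto
    then have "{(\<rho>, \<mu>)} \<subseteq> triggers R \<Gamma>" using er applicable_trigger by auto
    moreover have "fresh_choice \<Gamma> {(\<rho>, \<mu>)} (\<lambda>_. \<nu>)" using er by (auto simp: fresh_choice_def)
    moreover have "lhs (c (Suc i)) = \<Gamma> \<union> (\<Union>\<tau>\<in>{(\<rho>, \<mu>)}. new_atoms \<nu> \<tau>)"
      using er cs(2) by auto
    ultimately show ?thesis using er(1) unfolding rule_step_def
      by (intro exI[of _ "{(\<rho>, \<mu>)}"] exI[of _ "\<lambda>_. \<nu>"]) simp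
  qed (use cs in \<open>auto simp: rule_step_refl\<close>)
qed (simp add: rule_step_refl)

lemma rhs_incseq: "rhs (c i) \<subseteq> rhs (c (Suc i))"
proof -
  have "rhs d \<subseteq> rhs d'" if "calls d ds" "d' \<in> set ds" for d d' ds
    using that by (induction rule: calls.induct) auto
  then show ?thesis using step[of i] by auto
qed

lemma lhs_mono: "i \<le> j \<Longrightarrow> lhs (c i) \<subseteq> lhs (c j)"
  by (rule lift_Suc_mono_le[of "\<lambda>i. lhs (c i)"]) (rule rule_step_subset[OF lhs_rule_step])

lemma rhs_mono: "i \<le> j \<Longrightarrow> rhs (c i) \<subseteq> rhs (c j)"
  by (rule lift_Suc_mono_le[of "\<lambda>i. rhs (c i)"]) (rule rhs_incseq)

lemma finite_sequent: "finite (lhs (c i)) \<and> finite (rhs (c i))"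
proof (induction i)
  case 0
  then show ?case using finite_start by simp
next
  case (Suc i)
  show ?case using step[of i]
  proof
    assume "\<exists>cs. calls (c i) cs \<and> c (Suc i) \<in> set cs"
    then obtain cs where cs: "calls (c i) cs" "c (Suc i) \<in> set cs" by blast
    then show ?thesis
    proof cases
      case (er ps \<rho> qs \<Gamma> \<Delta> \<mu> \<nu>)
      have "\<rho> \<in> R" using er(1) rules_R[of i] by auto
      then have "finite (head \<rho>)" using R by (auto simp: rule_set_def existential_rule_def)
      then show ?thesis using er cs(2) Suc by (auto simp: new_atoms_def subst_atoms_def)
    qed (use cs Suc in auto)
  qed (use Suc in simp)
qed

lemma reduction_closed_UN:
  assumes "\<And>i. i \<in> A \<Longrightarrow> reduction_closed \<Gamma> (C i)"
  shows "reduction_closed \<Gamma> (\<Union>i\<in>A. C i)"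
  unfolding reduction_closed_def
proof
  fix \<chi> assume "\<chi> \<in> (\<Union>i\<in>A. C i)"
  then obtain i where i: "i \<in> A" "\<chi> \<in> C i" by blast
  have "case \<chi> of FAtom a \<Rightarrow> True | FAnd \<phi> \<psi> \<Rightarrow> \<phi> \<in> C i \<and> \<psi> \<in> C i
     | FEx x \<phi> \<Rightarrow> \<forall>t\<in>terms \<Gamma>. subst1 \<phi> t x \<in> C i"
    by (rule bspec[OF assms[OF i(1), unfolded reduction_closed_def] i(2)])
  then show "case \<chi> of FAtom a \<Rightarrow> True
      | FAnd \<phi> \<psi> \<Rightarrow> \<phi> \<in> (\<Union>i\<in>A. C i) \<and> \<psi> \<in> (\<Union>i\<in>A. C i)
      | FEx x \<phi> \<Rightarrow> \<forall>t\<in>terms \<Gamma>. subst1 \<phi> t x \<in> (\<Union>i\<in>A. C i)"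
    using i(1) by (cases \<chi>) auto
qed

lemma reduction_closed_insert:
  assumes "reduction_closed \<Gamma> C"
    and "case \<chi> of FAtom a \<Rightarrow> True | FAnd \<phi> \<psi> \<Rightarrow> \<phi> \<in> C \<and> \<psi> \<in> C
     | FEx x \<phi> \<Rightarrow> \<forall>t\<in>terms \<Gamma>. subst1 \<phi> t x \<in> C"
  shows "reduction_closed \<Gamma> (insert \<chi> C)"
  unfolding reduction_closed_def
proof
  fix \<chi>' assume "\<chi>' \<in> insert \<chi> C"
  then consider "\<chi>' = \<chi>" | "\<chi>' \<in> C" by blast
  then have "case \<chi>' of FAtom a \<Rightarrow> True | FAnd \<phi> \<psi> \<Rightarrow> \<phi> \<in> C \<and> \<psi> \<in> C
     | FEx x \<phi> \<Rightarrow> \<forall>t\<in>terms \<Gamma>. subst1 \<phi> t x \<in> C"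
    by cases (simp only: assms(2), rule bspec[OF assms(1)[unfolded reduction_closed_def]])
  then show "case \<chi>' of FAtom a \<Rightarrow> True
      | FAnd \<phi> \<psi> \<Rightarrow> \<phi> \<in> insert \<chi> C \<and> \<psi> \<in> insert \<chi> C
      | FEx x \<phi> \<Rightarrow> \<forall>t\<in>terms \<Gamma>. subst1 \<phi> t x \<in> insert \<chi> C"
    by (cases \<chi>') auto
qed

text \<open>Induction on \<open>size\<close>: a formula has finitely many immediate reducts, as
  \<open>terms \<Gamma>\<close> is finite, and all of them are smaller.\<close>

lemma finite_reduction_closure:
  assumes "finite \<Gamma>"
  shows "\<exists>C. finite C \<and> \<phi> \<in> C \<and> reduction_closed \<Gamma> C"
proof (induction \<phi> rule: measure_induct_rule[of size])
  case (less \<phi>)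
  show ?case
  proof (cases \<phi>)
    case (FAtom a)
    have "reduction_closed \<Gamma> {FAtom a}"
      by (simp add: reduction_closed_def)
    then show ?thesis unfolding FAtom by blast
  next
    case (FAnd \<phi>\<^sub>1 \<phi>\<^sub>2)
    have "size \<phi>\<^sub>1 < size \<phi>" "size \<phi>\<^sub>2 < size \<phi>" using FAnd by simp_all
    then obtain C\<^sub>1 C\<^sub>2 where C: "finite C\<^sub>1" "\<phi>\<^sub>1 \<in> C\<^sub>1" "reduction_closed \<Gamma> C\<^sub>1"
      "finite C\<^sub>2" "\<phi>\<^sub>2 \<in> C\<^sub>2" "reduction_closed \<Gamma> C\<^sub>2"
      using less[of \<phi>\<^sub>1] less[of \<phi>\<^sub>2] by blast
    have "reduction_closed \<Gamma> (\<Union>D\<in>{C\<^sub>1, C\<^sub>2}. D)"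
      by (rule reduction_closed_UN) (use C(3,6) in auto)
    then have "reduction_closed \<Gamma> (insert \<phi> (C\<^sub>1 \<union> C\<^sub>2))"
      by (intro reduction_closed_insert) (use C(2,5) FAnd in simp_all)
    then show ?thesis using C(1,4) by (intro exI[of _ "insert \<phi> (C\<^sub>1 \<union> C\<^sub>2)"]) simp
  next
    case (FEx x \<psi>)
    have "size (subst1 \<psi> t x) < size \<phi>" for t
      by (simp add: FEx subst1_def size_subst_fm)
    then have "\<exists>C. finite C \<and> subst1 \<psi> t x \<in> C \<and> reduction_closed \<Gamma> C" for t
      by (rule less)
    then obtain C where C: "\<And>t. finite (C t)" "\<And>t. subst1 \<psi> t x \<in> C t"
      "\<And>t. reduction_closed \<Gamma> (C t)"
      by metis
    have "reduction_closed \<Gamma> (\<Union>t\<in>terms \<Gamma>. C t)" by (intro reduction_closed_UN C(3))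
    then have "reduction_closed \<Gamma> (insert \<phi> (\<Union>t\<in>terms \<Gamma>. C t))"
      by (rule reduction_closed_insert) (use C(2) FEx in auto)
    then show ?thesis using C(1) finite_terms[OF assms]
      by (intro exI[of _ "insert \<phi> (\<Union>t\<in>terms \<Gamma>. C t)"]) simp
  qed
qed

text \<open>Otherwise the left-hand side would stay fixed forever while the right-hand side grew
  strictly inside a finite closed set.\<close>

lemma eventually_settled: "\<exists>j\<ge>i. settled (c j)"
proof (rule ccontr)
  assume "\<not> (\<exists>j\<ge>i. settled (c j))"
  then have unsettled: "\<not> settled (c (i + k))" for k by simp
  have "\<exists>C. finite C \<and> \<phi> \<in> C \<and> reduction_closed (lhs (c i)) C" for \<phi>
    using finite_reduction_closure finite_sequent by blast
  then obtain F where F: "\<And>\<phi>. finite (F \<phi>)" "\<And>\<phi>. \<phi> \<in> F \<phi>"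
    "\<And>\<phi>. reduction_closed (lhs (c i)) (F \<phi>)"
    by metis
  define C where "C = (\<Union>\<phi>\<in>rhs (c i). F \<phi>)"
  have C: "finite C" "reduction_closed (lhs (c i)) C"
    unfolding C_def using F finite_sequent by (auto intro: reduction_closed_UN)
  have lhs: "lhs (c (i + k)) = lhs (c i)" for k
    by (induction k) (use unsettled_step(1)[OF unsettled] in auto)
  have in_C: "rhs (c (i + k)) \<subseteq> C" for k
  proof (induction k)
    case 0
    then show ?case using F(2) by (auto simp: C_def)
  next
    case (Suc k)
    show ?case
      using unsettled_step(3)[OF unsettled[of k], of C] Suc C(2) by (simp add: lhs)
  qed
  have "k \<le> card (rhs (c (i + k)))" for k
  proof (induction k)
    case (Suc k)
    have "rhs (c (i + k)) \<subset> rhs (c (i + Suc k))"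
      using unsettled_step(2)[OF unsettled[of k]] by simp
    then have "card (rhs (c (i + k))) < card (rhs (c (i + Suc k)))"
      using finite_sequent psubset_card_mono by blast
    then show ?case using Suc by simp
  qed simp
  from this[of "Suc (card C)"] card_mono[OF C(1) in_C] show False
    by (metis not_less_eq_eq le_trans)
qed

section \<open>The limit of a branch as a counter-model\<close>

definition limit :: inst where
  "limit = (\<Union>i. lhs (c i))"

lemma lhs_subset_limit: "lhs (c i) \<subseteq> limit"
  by (auto simp: limit_def)

text \<open>Hintikka argument by induction on \<open>size\<close>. Formulae persist on the right, so
  each is still there at a later settled node, where a false conjunct or the relevant instance is
  present as well.\<close>

lemma rhs_refuted: "\<phi> \<in> rhs (c i) \<Longrightarrow> \<not> holds limit Var \<phi>"
proof (induction \<phi> arbitrary: i rule: measure_induct_rule[of size])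
  case (less \<phi>)
  show ?case
  proof (cases \<phi>)
    case (FAtom a)
    show ?thesis
    proof
      assume "holds limit Var \<phi>"
      then obtain j where "a \<in> lhs (c j)"
        using FAtom by (auto simp: limit_def subst_trm_Var atom.map_id)
      then have "axiomatic (lhs (c (max i j))) (rhs (c (max i j)))"
        using less.prems FAtom lhs_mono[of j "max i j"] rhs_mono[of i "max i j"]
        by (auto simp: axiomatic_def)
      then show False using not_axiomatic by blast
    qed
  next
    case (FAnd \<phi>\<^sub>1 \<phi>\<^sub>2)
    obtain j where j: "j \<ge> i" "settled (c j)" using eventually_settled by blast
    then have "FAnd \<phi>\<^sub>1 \<phi>\<^sub>2 \<in> rhs (c j)" using less.prems FAnd rhs_mono by blast
    then have "\<phi>\<^sub>1 \<in> rhs (c j) \<or> \<phi>\<^sub>2 \<in> rhs (c j)"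
      using j(2) by (auto simp: settled_def and_reducible_def)
    then show ?thesis using less.IH FAnd by auto
  next
    case (FEx x \<psi>)
    show ?thesis
    proof
      assume "holds limit Var \<phi>"
      then obtain t where t: "t \<in> terms limit" "holds limit (Var(x := t)) \<psi>"
        using FEx by auto
      then obtain k where k: "t \<in> terms (lhs (c k))" by (auto simp: limit_def terms_def)
      \<comment> \<open>At node \<open>j\<close> the quantified formula is on the right,
        \<open>t\<close> occurs on the left, and all reductions are exhausted.\<close>
      obtain j where j: "j \<ge> max i k" "settled (c j)" using eventually_settled by blast
      then have "FEx x \<psi> \<in> rhs (c j)" "t \<in> terms (lhs (c j))"
        using less.prems FEx k rhs_mono[of i j] terms_mono[OF lhs_mono[of k j]] by auto
      then have "subst1 \<psi> t x \<in> rhs (c j)"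
        using j(2) by (auto simp: settled_def ex_reducible_def)
      then have "\<not> holds limit Var (subst1 \<psi> t x)"
        using less.IH FEx by (simp add: subst1_def size_subst_fm)
      then show False using t(2) by (simp add: holds_subst1 subst_trm_Var)
    qed
  qed
qed

lemma limit_rule_model: "rule_model R limit"
  unfolding rule_model_def
proof (intro ballI allI impI)
  fix \<rho> \<mu> assume \<rho>: "\<rho> \<in> R" and \<mu>: "subst_atoms \<mu> (body \<rho>) \<subseteq> limit"
  have "finite (body \<rho>)" using R \<rho> by (auto simp: rule_set_def existential_rule_def)
  then have "finite (subst_atoms \<mu> (body \<rho>))" by (simp add: subst_atoms_def)
  then obtain i where i: "subst_atoms \<mu> (body \<rho>) \<subseteq> lhs (c i)"
    using finite_subset_UN_incseq[of "\<lambda>i. lhs (c i)", OF rule_step_subset[OF lhs_rule_step]] \<mu>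
    unfolding limit_def by metis
  let ?\<mu> = "restrict \<mu> (vars (body \<rho>))"
  \<comment> \<open>If the instance is not applicable at \<open>i\<close>, then \<open>j = i\<close>
    will do; otherwise fairness provides \<open>j\<close>. As the body stays matched, the head must
    be satisfied at \<open>j\<close>.\<close>
  obtain j where j: "j \<ge> i" "\<not> applicable (lhs (c j)) \<rho> ?\<mu>"
    using fairness[OF \<rho>] by blast
  have ij: "subst_atoms \<mu> (body \<rho>) \<subseteq> lhs (c j)" using i lhs_mono[OF j(1)] by blast
  have "subst_atoms ?\<mu> (body \<rho>) = subst_atoms \<mu> (body \<rho>)" by (rule subst_atoms_cong) simp
  moreover have "?\<mu> \<in> assignments (vars (body \<rho>)) (lhs (c j))"
    using subst_var_in_terms[OF _ ij] by (auto simp: assignments_def)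
  ultimately obtain \<theta> where
    "subst_atoms (override_on ?\<mu> \<theta> (exvars \<rho>)) (head \<rho>) \<subseteq> lhs (c j)"
    using j(2) ij unfolding applicable_def by auto
  moreover have "subst_atoms (override_on ?\<mu> \<theta> (exvars \<rho>)) (head \<rho>) =
      subst_atoms (override_on \<mu> \<theta> (exvars \<rho>)) (head \<rho>)"
    by (rule subst_override_on_cong) simp
  ultimately show "\<exists>\<theta>. subst_atoms (override_on \<mu> \<theta> (exvars \<rho>)) (head \<rho>) \<subseteq> limit"
    using lhs_subset_limit by blast
qed

lemma limit_universal:
  "rule_model R M \<Longrightarrow> lhs (c 0) \<subseteq> M \<Longrightarrow> \<exists>e. subst_atoms e limit \<subseteq> M"
  unfolding limit_def
  by (rule rule_steps_limit_universal[where S = "\<lambda>i. lhs (c i)", OF _ lhs_rule_step])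

end

lemma open_branch_padded:
  assumes R: "rule_set R" and D: "finite D" and T: "proof_search R D \<phi> T" and b: "open_branch T b n"
  obtains c where "branch R c" "c 0 = call T" "extracted b n = top_closure (branch.limit c)"
proof -
  \<comment> \<open>The index is capped at the last node of a finite branch; on an infinite branch
    the test always succeeds and \<open>the_enat\<close> is never reached.\<close>
  define c where "c i = call (b (if enat i \<le> n then i else the_enat n))" for i
  have b0: "b 0 = T" using b by (simp add: open_branch_def path_def)
  have tree: "search_tree T" "fair R T" "set (rules (call T)) = R"
    "lhs (call T) = D" "rhs (call T) = {\<phi>}"
    using T by (auto simp: proof_search_def)
  have next_b: "b (Suc i) \<in> set (children (b i))" if "enat i < n" for i
    using b that by (simp add: open_branch_def path_def)
  \<comment> \<open>The bound on \<open>i\<close> matters: \<open>path\<close> does not constrain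
    \<open>b\<close> beyond \<open>n\<close>.\<close>
  have b_tree: "search_tree (b i) \<and> set (rules (call (b i))) = R" if "enat i \<le> n" for i
    using that
  proof (induction i)
    case (Suc i)
    have i: "enat i < n" using Suc.prems by (simp add: Suc_ile_eq)
    then have IH: "search_tree (b i)" "set (rules (call (b i))) = R" using Suc.IH by auto
    have "calls (call (b i)) (map call (children (b i)))" using IH(1) by (rule search_tree_calls)
    from calls_rules[OF this] next_b[OF i] IH search_tree_child[OF IH(1)] show ?case by auto
  qed (use b0 tree in \<open>simp add: zero_enat_def[symmetric]\<close>)
  have c_le: "c i = call (b i)" if "enat i \<le> n" for i using that by (simp add: c_def)
  have c_end: "call_saturated (c i) \<and> c (Suc i) = c i" if i: "\<not> enat i < n" for i
  proof -
    obtain m where m: "n = enat m" "call_saturated (call (b m))"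
      using b i by (auto simp: open_branch_def)
    then have "c i = call (b m)" "c (Suc i) = call (b m)" using i by (auto simp: c_def)
    then show ?thesis using m by simp
  qed
  have c_step: "\<exists>cs. calls (c i) cs \<and> c (Suc i) \<in> set cs" if "enat i < n" for i
  proof -
    have "calls (call (b i)) (map call (children (b i)))"
      using b_tree[of i] that by (intro search_tree_calls) simp
    then show ?thesis using next_b[OF that] that by (auto simp: c_le Suc_ile_eq)
  qed
  have c_rules: "set (rules (c i)) = R" for i
  proof (cases n)
    case (enat m)
    then show ?thesis using b_tree by (simp add: c_def)
  next
    case infinity
    then show ?thesis using b_tree by (simp add: c_def)
  qed
  have branch: "branch R c"
  proof
    fix i show "(\<exists>cs. calls (c i) cs \<and> c (Suc i) \<in> set cs) \<or> call_saturated (c i) \<and> c (Suc i) = c i"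
      using c_end c_step by blast
  next
    fix \<rho> i \<mu> assume \<rho>: "\<rho> \<in> R" "applicable (lhs (c i)) \<rho> \<mu>"
    show "\<exists>j\<ge>i. \<not> applicable (lhs (c j)) \<rho> \<mu>"
    proof (cases n)
      case (enat m)
      \<comment> \<open>From index \<open>m\<close> on the padded branch repeats its saturated end,
        where no instance of a rule in \<open>R\<close> is applicable.\<close>
      have "call_saturated (c (max i m))" using c_end[of "max i m"] enat by simp
      then have "\<not> applicable (lhs (c (max i m))) \<rho> \<mu>"
        using \<rho>(1) c_rules[of "max i m"]
        unfolding call_saturated_def saturated_def applicable_def by blast
      then show ?thesis by (intro exI[of _ "max i m"]) simp
    next
      case infinity
      then have "c = (\<lambda>i. call (b i))" by (auto simp: c_def)
      moreover have "path T b \<infinity>" using b infinity by (simp add: open_branch_def)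
      ultimately show ?thesis using tree(2) \<rho> unfolding fair_def by blast
    qed
  qed (use R D b0 tree c_rules c_le[of 0] in \<open>auto simp: zero_enat_def[symmetric]\<close>)
  have c0: "c 0 = call T" using c_le[of 0] b0 by (simp add: zero_enat_def[symmetric])
  have "(\<Union>i\<in>{i. enat i \<le> n}. lhs (call (b i))) = (\<Union>i. lhs (c i))"
  proof
    show "(\<Union>i\<in>{i. enat i \<le> n}. lhs (call (b i))) \<subseteq> (\<Union>i. lhs (c i))"
    proof (intro UN_least)
      fix i assume "i \<in> {i. enat i \<le> n}"
      then show "lhs (call (b i)) \<subseteq> (\<Union>i. lhs (c i))" using c_le[of i] UN_upper[of i UNIV "\<lambda>i. lhs (c i)"] by simp
    qed
    show "(\<Union>i. lhs (c i)) \<subseteq> (\<Union>i\<in>{i. enat i \<le> n}. lhs (call (b i)))"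
    proof (rule UN_least)
      fix i
      have "enat (if enat i \<le> n then i else the_enat n) \<le> n" by (cases n) auto
      then show "lhs (c i) \<subseteq> (\<Union>i\<in>{i. enat i \<le> n}. lhs (call (b i)))"
        unfolding c_def by (intro UN_upper) simp
    qed
  qed
  then have "extracted b n = top_closure (branch.limit c)"
    by (simp only: extracted_def branch.limit_def[OF branch])
  with branch c0 show ?thesis by (rule that)
qed

section \<open>Combining soundness, completeness and universality\<close>

theorem theorem10:
  fixes R :: "rule set" and D :: inst and xs :: "nat list" and q :: fm
    and Ch :: "nat \<Rightarrow> inst" and T :: tree
  assumes "rule_set R" and "database D" and "bcq xs q"
    and "chase R D Ch"
    and "proof_search R D (exists_fm xs q) T"
  shows "((returns T True \<longleftrightarrow> (\<exists>n. satisfies (Ch n) xs q)) \<and>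
          ((\<exists>n. satisfies (Ch n) xs q) \<longleftrightarrow> satisfies (chase_limit Ch) xs q)) \<and>
         (\<not> returns T True \<longrightarrow>
            (\<exists>I. witnessing_counter_model T I) \<and>
            (\<forall>I. witnessing_counter_model T I \<longrightarrow> hom_equiv I (chase_limit Ch)))"
proof -
  let ?J = "\<Union>n. Ch n"
  have T: "search_tree T" "set (rules (call T)) = R" "lhs (call T) = D"
    "rhs (call T) = {exists_fm xs q}"
    using assms(5) by (auto simp: proof_search_def)
  have D: "finite D" using assms(2) by (simp add: database_def)
  have Ch0: "Ch 0 = D" using assms(4) by (simp add: chase_def)
  have J_model: "rule_model R ?J" by (rule chase_rule_model[OF assms(1,4)])
  have D_J: "D \<subseteq> ?J" using Ch0 by blast
  have sat_J: "satisfies ?J xs q \<longleftrightarrow> (\<exists>n. satisfies (Ch n) xs q)"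
    by (rule satisfies_UN_incseq[where S = Ch, OF assms(3) chase_incseq[OF assms(4)]])
  have limit: "satisfies (chase_limit Ch) xs q \<longleftrightarrow> satisfies ?J xs q"
    unfolding chase_limit_def by (rule satisfies_top_closure[OF assms(3)])
  have sound: "satisfies ?J xs q" if "returns T True"
    using returns_True_sound[OF that T(1), of ?J Var] T J_model D_J
    by (simp add: subst_atoms_Var holds_exists_fm_iff_satisfies[OF assms(3)])
  have J_to: "\<exists>e. subst_atoms e ?J \<subseteq> M" if "rule_model R M" "D \<subseteq> M" for M
    using rule_steps_limit_universal[where S = Ch, OF that(1) chase_rule_step[OF assms(4)]]
      that(2) Ch0 by simp
  \<comment> \<open>On an open branch the limit is a model of \<open>R\<close> containing
    \<open>D\<close>, so the chase maps into it and carries the query match along; but the query is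
    on the right of the root and hence refuted.\<close>
  have complete: "returns T True" if sat: "satisfies ?J xs q"
  proof (rule ccontr)
    assume "\<not> returns T True"
    then obtain b n where "open_branch T b n" using open_branch_exists[OF T(1)] by blast
    then obtain c where c: "branch R c" "c 0 = call T"
      by (rule open_branch_padded[OF assms(1) D assms(5)])
    interpret branch R c by (rule c(1))
    have "D \<subseteq> limit" using lhs_subset_limit[of 0] c(2) T(3) by simp
    then obtain e where e: "subst_atoms e ?J \<subseteq> limit" using J_to limit_rule_model by blast
    obtain \<mu> where "subst_atoms \<mu> (conjuncts q) \<subseteq> ?J"
      using sat unfolding satisfies_iff[OF assms(3)] by blast
    from subst_atoms_mono[OF this, of e] e have "satisfies limit xs q"
      unfolding satisfies_iff[OF assms(3)] subst_atoms_comp by blast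
    then have "holds limit Var (exists_fm xs q)"
      by (simp add: holds_exists_fm_iff_satisfies[OF assms(3)])
    then show False using rhs_refuted[of _ 0] c(2) T(4) by simp
  qed
  have "hom_equiv I (chase_limit Ch)" if I: "witnessing_counter_model T I" for I
  proof -
    obtain b n where b: "open_branch T b n" "I = extracted b n"
      using I by (auto simp: witnessing_counter_model_def)
    obtain c where c: "branch R c" "c 0 = call T" "extracted b n = top_closure (branch.limit c)"
      by (rule open_branch_padded[OF assms(1) D assms(5) b(1)])
    interpret branch R c by (rule c(1))
    have D_limit: "D \<subseteq> limit" using lhs_subset_limit[of 0] c(2) T(3) by simp
    \<comment> \<open>Each limit is a model containing \<open>D\<close> and maps into every such
      model, so the two map into each other.\<close>
    obtain e e' where "subst_atoms e limit \<subseteq> ?J" "subst_atoms e' ?J \<subseteq> limit"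
      using J_to[OF limit_rule_model D_limit] limit_universal[OF J_model] D_J c(2) T(3) by auto
    then show ?thesis
      unfolding b(2) c(3) chase_limit_def by (rule hom_equiv_top_closure)
  qed
  moreover have "\<exists>I. witnessing_counter_model T I" if "\<not> returns T True"
    using open_branch_exists[OF T(1) that] by (auto simp: witnessing_counter_model_def)
  moreover have "returns T True \<longleftrightarrow> satisfies ?J xs q" using sound complete by (rule iffI)
  ultimately show ?thesis unfolding sat_J[symmetric] limit by simp
qed

end
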